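(* For every fixed integer $r\ge 4$, the limit $\lim_{n\to\infty}\frac{f_r(n,3r-4,3)}{n^2}$ exists and $$\lim_{n\to\infty}\frac{f_r(n,3r-4,3)}{n^2}=\frac{1}{r^2-r-1}.$$
   Context: An $r$-uniform hypergraph ($r$-graph) on a vertex set $V$ is a family of distinct $r$-element subsets of $V$, called edges. For integers $r\ge 2$, $e\ge 2$, $v\ge r+1$, an $r$-graph is called $\mathscr{G}_r(v,e)$-free if the union of any $e$ distinct edges of it contains at least $v+1$ vertices. $f_r(n,v,e)$ denotes the maximum number of edges in a $\mathscr{G}_r(v,e)$-free $r$-graph on $n$ vertices. *)

theory Defs
  imports Complex_Main
begin

definition uniform_hypergraph :: "nat \<Rightarrow> 'a set \<Rightarrow> 'a set set \<Rightarrow> bool" where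
  "uniform_hypergraph r V E \<longleftrightarrow> (\<forall>A\<in>E. A \<subseteq> V \<and> card A = r)"

definition G_free :: "nat \<Rightarrow> nat \<Rightarrow> 'a set set \<Rightarrow> bool" where
  "G_free v e E \<longleftrightarrow> (\<forall>S. S \<subseteq> E \<and> card S = e \<longrightarrow> v + 1 \<le> card (\<Union>S))"

text \<open>The maximum does not depend on the choice of the \<open>n\<close>-element vertex set, so we
  take \<open>{..<n}\<close>. It ranges over a finite set (\<open>finite_free_sizes\<close>), nonempty
  for \<open>e \<ge> 1\<close> (\<open>free_sizes_nonempty\<close>).\<close>

definition f_max :: "nat \<Rightarrow> nat \<Rightarrow> nat \<Rightarrow> nat \<Rightarrow> nat" where
  "f_max r n v e =
    Max {card E | E :: nat set set. uniform_hypergraph r {..<n} E \<and> G_free v e E}"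

lemma finite_free_sizes:
  "finite {card E | E :: nat set set. uniform_hypergraph r {..<n} E \<and> G_free v e E}"
proof (rule finite_subset)
  show "{card E | E :: nat set set. uniform_hypergraph r {..<n} E \<and> G_free v e E}
      \<subseteq> card ` Pow (Pow {..<n})"
    by (auto simp: uniform_hypergraph_def)
qed simp

lemma free_sizes_nonempty:
  assumes "e \<ge> 1"
  shows "{card E | E :: nat set set. uniform_hypergraph r {..<n} E \<and> G_free v e E} \<noteq> {}"
proof -
  have "uniform_hypergraph r {..<n} {}" "G_free v e ({} :: nat set set)"
    using assms by (auto simp: uniform_hypergraph_def G_free_def)
  then show ?thesis by blast
qed

end

theory Submission
  imports Defs "HOL-Number_Theory.Number_Theory"
begin

text \<open>
  Two edges with exactly two common vertices \<open>u, v\<close> form a gadget: no other edge meets their union in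
  more than one vertex. It covers \<open>r\<^sup>2 - r - 1\<close> pairs, which gives the upper bound after double counting
  covered pairs; edges with three or more common vertices are negligible.

  For the lower bound one packs gadgets so that almost all pairs are covered although none of the
  \<open>(r - 2)\<^sup>2\<close> cross pairs of a gadget is ever covered. Colour the differences in \<open>\<int>/p\<close> by the
  cosets of the multiplicative subgroup of index \<open>M = 2 ^ j\<close>. A second moment computation shows that for
  large \<open>p\<close> every prescribed edge colouring of a clique occurs. Hence there are \<open>s \<approx> M / (r\<^sup>2 - r - 1)\<close>
  base gadgets whose cross differences all have colour \<open>0\<close> and whose other differences have pairwise
  distinct nonzero colours. Their images under \<open>z \<mapsto> x * z + b\<close>, with \<open>x\<close> in the subgroup modulo sign,
  cover every pair at most once and no pair of colour \<open>0\<close>. A transversal design spreads this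
  single example over all large \<open>n\<close> without loss of density.
\<close>


section \<open>Sparse triples and the upper bound\<close>

text \<open>A local condition stronger than \<open>G_free (3 * r - 4) 3\<close>, which would also
  admit two edges with three or more common vertices. Being stated through pairwise intersections
  and partners, it survives when copies of a hypergraph are put together.\<close>

definition sparse_triples :: "'a set set \<Rightarrow> bool" where
  "sparse_triples E \<longleftrightarrow>
    (\<forall>A\<in>E. \<forall>B\<in>E. A \<noteq> B \<longrightarrow> card (A \<inter> B) \<le> 2) \<and>
    (\<forall>A\<in>E. \<forall>B\<in>E. \<forall>C\<in>E. A \<noteq> B \<and> C \<noteq> A \<and> C \<noteq> B \<and> card (A \<inter> B) = 2
       \<longrightarrow> card (C \<inter> (A \<union> B)) \<le> 1)"

lemma card_Un_three:
  assumes "finite A" "finite B" "finite C"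
  shows "card (A \<union> B \<union> C) + card (C \<inter> (A \<union> B)) + card (A \<inter> B) = card A + card B + card C"
proof -
  have "card (A \<union> B) + card C = card (A \<union> B \<union> C) + card (C \<inter> (A \<union> B))"
    using card_Un_Int[of "A \<union> B" C] assms by (simp only: finite_Un Int_commute[of "A \<union> B"])
  then show ?thesis using card_Un_Int[of A B] assms by linarith
qed

text \<open>The union of three edges falls short of \<open>3 * r\<close> by
  \<open>card (A \<inter> B) + card (C \<inter> (A \<union> B))\<close>, so a loss of at most 3 is
  needed. If two of them meet in two vertices, the third adds at most 1 to the loss; otherwise all
  three pairwise intersections have at most one vertex.\<close>

lemma G_free_if_sparse_triples:
  assumes unif: "uniform_hypergraph r V E" and sp: "sparse_triples E" and r: "r \<ge> 2"
  shows "G_free (3 * r - 4) 3 E"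
  unfolding G_free_def
proof (intro allI impI, elim conjE)
  fix S assume S: "S \<subseteq> E" "card S = 3"
  then obtain A B C where SE: "S = {A, B, C}" and ne: "A \<noteq> B" "B \<noteq> C" "A \<noteq> C"
    by (metis card_3_iff)
  have E: "A \<in> E" "B \<in> E" "C \<in> E" using S SE by auto
  have c: "card A = r" "card B = r" "card C = r"
    using E unif by (auto simp: uniform_hypergraph_def)
  have fin: "finite A" "finite B" "finite C"
    using c r by (auto intro: card_ge_0_finite)
  have le2: "card (X \<inter> Y) \<le> 2" if "X \<in> E" "Y \<in> E" "X \<noteq> Y" for X Y
    using sp that unfolding sparse_triples_def by blast
  have two: "card (Z \<inter> (X \<union> Y)) \<le> 1"
    if "X \<in> E" "Y \<in> E" "Z \<in> E" "X \<noteq> Y" "Z \<noteq> X" "Z \<noteq> Y" "card (X \<inter> Y) = 2" for X Y Z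
    using sp that unfolding sparse_triples_def by blast
  have main: "3 * r - 4 + 1 \<le> card (X \<union> Y \<union> Z)"
    if h: "X \<in> E" "Y \<in> E" "Z \<in> E" "X \<noteq> Y" "Z \<noteq> X" "Z \<noteq> Y" "card (X \<inter> Y) = 2"
      "card X = r" "card Y = r" "card Z = r" "finite X" "finite Y" "finite Z" for X Y Z
    using card_Un_three[of X Y Z] two[of X Y Z] h r by simp
  have "3 * r - 4 + 1 \<le> card (A \<union> B \<union> C)"
  proof (cases "card (A \<inter> B) = 2 \<or> card (A \<inter> C) = 2 \<or> card (B \<inter> C) = 2")
    case True
    then show ?thesis
      using main[of A B C] main[of A C B] main[of B C A] E ne c fin
      by (auto simp: Un_ac)
  next
    case False
    then have "card (A \<inter> B) \<le> 1" "card (A \<inter> C) \<le> 1" "card (B \<inter> C) \<le> 1"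
      using le2[of A B] le2[of A C] le2[of B C] E ne by auto
    moreover have "card (C \<inter> (A \<union> B)) \<le> card (A \<inter> C) + card (B \<inter> C)"
      by (metis Int_Un_distrib Int_commute card_Un_le)
    ultimately show ?thesis
      using card_Un_three[OF fin] c r by simp
  qed
  then show "3 * r - 4 + 1 \<le> card (\<Union> S)"
    by (simp add: SE Un_assoc)
qed

section \<open>The upper bound by weighted counting of pairs\<close>

text \<open>Edges meeting another edge in three or more vertices number at most
  \<open>2 * card V\<close>. Among the others, each pair of vertices spreads weight 1 evenly over
  the edges containing it. An edge shares at most one of its pairs, and with one other edge only, so
  it collects at least \<open>(r choose 2) - 1 / 2\<close>, which is half of
  \<open>r * r - r - 1\<close>.\<close>

lemma card_free_le:
  fixes E :: "'a set set"
  assumes unif: "uniform_hypergraph r V E" and free: "G_free (3 * r - 4) 3 E"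
    and V: "finite V" and r: "r \<ge> 2"
  shows "real (card E) * ((real r)\<^sup>2 - real r - 1)
    \<le> (real (card V))\<^sup>2 + 2 * real (card V) * ((real r)\<^sup>2 - real r - 1)"
proof -
  have EV: "A \<subseteq> V" "card A = r" "finite A" if "A \<in> E" for A
    using unif that V by (auto simp: uniform_hypergraph_def intro: finite_subset)
  have finE: "finite E"
    by (rule finite_subset[of _ "Pow V"]) (use EV V in auto)
  \<comment> \<open>Freeness as a budget: the overlaps of three distinct edges cost at most
    \<open>3 * r - (3 * r - 3) = 3\<close> vertices.\<close>
  have triple: "card (C \<inter> (A \<union> B)) + card (A \<inter> B) \<le> 3"
    if "A \<in> E" "B \<in> E" "C \<in> E" "A \<noteq> B" "C \<noteq> A" "C \<noteq> B" for A B C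
  proof -
    have "card {A, B, C} = 3" using that by auto
    then have "3 * r - 4 + 1 \<le> card (\<Union> {A, B, C})"
      using free[unfolded G_free_def, rule_format, of "{A, B, C}"] that by simp
    then have "3 * r - 4 + 1 \<le> card (A \<union> B \<union> C)" by (simp add: Un_assoc)
    then show ?thesis
      using card_Un_three[of A B C] EV(2,3)[OF that(1)] EV(2,3)[OF that(2)] EV(2,3)[OF that(3)] r
      by simp
  qed
  define E1 where "E1 = {A \<in> E. \<exists>B\<in>E. B \<noteq> A \<and> card (A \<inter> B) \<ge> 3}"
  define E2 where "E2 = E - E1"
  have fin12: "finite E1" "finite E2" using finE by (auto simp: E1_def E2_def)
  \<comment> \<open>An edge \<open>A\<close> of \<open>E1\<close> and its partner \<open>B\<close>
    exhaust the budget 3, so no third edge touches their union; only \<open>A\<close> and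
    \<open>B\<close> can contain a vertex of \<open>A\<close>.\<close>
  have star: "card {A \<in> E1. v \<in> A} \<le> 2" for v
  proof (cases "{A \<in> E1. v \<in> A} = {}")
    case True
    then show ?thesis by (metis card.empty zero_le)
  next
    case False
    then obtain A where A: "A \<in> E" "A \<in> E1" "v \<in> A" by (auto simp: E1_def)
    then obtain B where B: "B \<in> E" "B \<noteq> A" "card (A \<inter> B) \<ge> 3" by (auto simp: E1_def)
    have "{A \<in> E1. v \<in> A} \<subseteq> {A, B}"
    proof (rule ccontr)
      assume "\<not> ?thesis"
      then obtain C where C: "C \<in> E" "v \<in> C" "C \<noteq> A" "C \<noteq> B" by (auto simp: E1_def)
      then have "card (C \<inter> (A \<union> B)) > 0" using A EV[OF C(1)] by (auto simp: card_gt_0_iff)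
      then show False using triple[of A B C] A B C by auto
    qed
    then have "card {A \<in> E1. v \<in> A} \<le> card {A, B}" by (intro card_mono) auto
    also have "\<dots> \<le> 2" by (simp add: card_insert_if)
    finally show ?thesis .
  qed
  have E1_le: "card E1 \<le> 2 * card V"
  proof -
    have "A \<inter> V \<noteq> {}" if "A \<in> E1" for A
      using EV[of A] that r by (auto simp: E1_def Int_absorb2)
    then have "E1 \<subseteq> (\<Union>v\<in>V. {A \<in> E1. v \<in> A})" by blast
    then have "card E1 \<le> card (\<Union>v\<in>V. {A \<in> E1. v \<in> A})"
      using V fin12 by (intro card_mono) auto
    also have "\<dots> \<le> (\<Sum>v\<in>V. card {A \<in> E1. v \<in> A})" by (rule card_UN_le[OF V])
    also have "\<dots> \<le> (\<Sum>v\<in>V. 2)" by (intro sum_mono star)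
    finally show ?thesis by simp
  qed
  define pairs where "pairs A = {P. P \<subseteq> A \<and> card P = 2}" for A :: "'a set"
  have fin_pairs: "finite (pairs A)" if "finite A" for A
    using that by (auto simp: pairs_def)
  define d where "d P = card {A \<in> E2. P \<subseteq> A}" for P
  \<comment> \<open>Three edges through one pair would lose \<open>2 + 2 > 3\<close>
    vertices.\<close>
  have d_le: "d P \<le> 2" if P: "card P = 2" for P
  proof (rule ccontr)
    assume "\<not> ?thesis"
    then have "3 \<le> card {A \<in> E2. P \<subseteq> A}" by (simp add: d_def)
    then obtain S where S: "S \<subseteq> {A \<in> E2. P \<subseteq> A}" "card S = 3"
      by (rule obtain_subset_with_card_n)
    obtain A B C where "S = {A, B, C}" "A \<noteq> B" "C \<noteq> A" "C \<noteq> B"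
      using S(2) unfolding card_3_iff by blast
    with S(1) have ABC: "A \<in> E" "B \<in> E" "C \<in> E" "A \<noteq> B" "C \<noteq> A" "C \<noteq> B"
      "P \<subseteq> A" "P \<subseteq> B" "P \<subseteq> C"
      by (auto simp: E2_def)
    have "card P \<le> card (A \<inter> B)" "card P \<le> card (C \<inter> (A \<union> B))"
      using ABC EV by (auto intro!: card_mono)
    then show False using triple[of A B C] ABC P by simp
  qed
  have weight: "real (r choose 2) - 1 / 2 \<le> (\<Sum>P\<in>pairs A. 1 / real (d P))"
    if A: "A \<in> E2" for A
  proof -
    have AE: "A \<in> E" using A by (simp add: E2_def)
    define D where "D = {P \<in> pairs A. d P = 2}"
    have fpA: "finite (pairs A)" using fin_pairs EV(3)[OF AE] .
    have partner: "\<exists>B. B \<in> E2 \<and> B \<noteq> A \<and> P \<subseteq> B" if "P \<in> D" for P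
    proof (rule ccontr)
      assume "\<not> ?thesis"
      then have "{A \<in> E2. P \<subseteq> A} \<subseteq> {A}" by auto
      then have "d P \<le> 1" unfolding d_def by (metis card.empty card.insert_remove card_mono finite.emptyI finite.insertI empty_Diff One_nat_def)
      then show False using that by (simp add: D_def)
    qed
    \<comment> \<open>Two shared pairs with the same partner would give an intersection of at least
      three vertices and put \<open>A\<close> into \<open>E1\<close>; with different partners the
      loss would again be at least \<open>2 + 2\<close>.\<close>
    have "P = P'" if PP: "P \<in> D" "P' \<in> D" for P P'
    proof (rule ccontr)
      assume ne: "P \<noteq> P'"
      obtain B where B: "B \<in> E2" "B \<noteq> A" "P \<subseteq> B" using partner PP by blast
      obtain B' where B': "B' \<in> E2" "B' \<noteq> A" "P' \<subseteq> B'" using partner PP by blast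
      have c: "P \<subseteq> A" "P' \<subseteq> A" "card P = 2" "card P' = 2"
        using PP by (auto simp: D_def pairs_def)
      have f: "finite P" "finite P'" using c by (auto intro: card_ge_0_finite)
      show False
      proof (cases "B = B'")
        case True
        have "P \<subset> P \<union> P'" using ne c f by (metis Un_upper1 Un_upper2 card_subset_eq psubsetI)
        then have "card P < card (P \<union> P')" using f by (intro psubset_card_mono) auto
        also have "\<dots> \<le> card (A \<inter> B)"
          using EV(3)[OF AE] c B B' True by (intro card_mono) auto
        finally have "A \<in> E1" using c B AE by (auto simp: E1_def E2_def)
        then show False using A by (simp add: E2_def)
      next
        case False
        have "P \<subseteq> A \<inter> B" "P' \<subseteq> B' \<inter> (A \<union> B)" using c B B' by auto
        moreover have "finite (A \<inter> B)" "finite (B' \<inter> (A \<union> B))"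
          using EV(3)[OF AE] EV(3)[of B'] B' by (auto simp: E2_def)
        ultimately have "card P \<le> card (A \<inter> B)" "card P' \<le> card (B' \<inter> (A \<union> B))"
          by (simp_all add: card_mono)
        then show False using triple[of A B B'] AE B B' False c by (auto simp: E2_def)
      qed
    qed
    then have D1: "card D \<le> 1"
      using fpA by (subst card_le_Suc0_iff_eq[unfolded One_nat_def[symmetric]]) (auto simp: D_def)
    have "1 - (if P \<in> D then 1 / 2 else 0) = 1 / real (d P)" if P: "P \<in> pairs A" for P
    proof -
      have "A \<in> {A \<in> E2. P \<subseteq> A}" using A P by (auto simp: pairs_def)
      then have "d P > 0" using fin12 by (auto simp: d_def card_gt_0_iff)
      moreover have "d P \<le> 2" using d_le P by (auto simp: pairs_def)
      ultimately have "d P = 1 \<or> d P = 2" by linarith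
      then show ?thesis using P by (auto simp: D_def)
    qed
    then have "(\<Sum>P\<in>pairs A. 1 / real (d P)) = (\<Sum>P\<in>pairs A. 1 - (if P \<in> D then 1 / 2 else 0))"
      by (intro sum.cong) auto
    also have "\<dots> = real (card (pairs A)) - (\<Sum>P\<in>pairs A. if P \<in> D then 1 / 2 else 0)"
      by (simp add: sum_subtractf)
    also have "(\<Sum>P\<in>pairs A. if P \<in> D then 1 / 2 else 0) = real (card D) / 2"
      using fpA by (subst sum.inter_restrict[symmetric]) (auto simp: D_def Int_def)
    also have "card (pairs A) = r choose 2"
      using n_subsets[OF EV(3)[OF AE]] EV(2)[OF AE] by (simp add: pairs_def)
    finally show ?thesis using D1 by simp
  qed
  have "real (card E2) * (real (r choose 2) - 1 / 2) \<le> (\<Sum>A\<in>E2. \<Sum>P\<in>pairs A. 1 / real (d P))"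
    using sum_mono[of E2 "\<lambda>_. real (r choose 2) - 1 / 2", OF weight] by simp
  also have "\<dots> = (\<Sum>A\<in>E2. \<Sum>P\<in>{P \<in> pairs V. P \<subseteq> A}. 1 / real (d P))"
  proof (rule sum.cong[OF refl])
    fix A assume "A \<in> E2"
    then have "pairs A = {P \<in> pairs V. P \<subseteq> A}"
      using EV(1)[of A] by (auto simp: pairs_def E2_def)
    then show "(\<Sum>P\<in>pairs A. 1 / real (d P)) = (\<Sum>P\<in>{P \<in> pairs V. P \<subseteq> A}. 1 / real (d P))"
      by simp
  qed
  also have "\<dots> = (\<Sum>P\<in>pairs V. \<Sum>A\<in>{A \<in> E2. P \<subseteq> A}. 1 / real (d P))"
    by (intro sum.swap_restrict fin12 fin_pairs V)
  \<comment> \<open>The inner sum has \<open>d P\<close> equal terms \<open>1 / d P\<close>. It is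
    1, or 0 when no edge of \<open>E2\<close> contains \<open>P\<close>.\<close>
  also have "\<dots> \<le> (\<Sum>P\<in>pairs V. 1)"
    by (intro sum_mono) (simp add: d_def)
  also have "\<dots> = real (card V choose 2)"
    using n_subsets[OF V] by (simp add: pairs_def)
  finally have E2_le: "real (card E2) * (real (r choose 2) - 1 / 2) \<le> real (card V choose 2)" .
  have choose2: "real (k choose 2) = real k * (real k - 1) / 2" for k
  proof -
    have "even (k * (k - 1))" by (cases k) auto
    then have "real (k choose 2) = real (k * (k - 1)) / 2"
      unfolding choose_two by (simp add: real_of_nat_div)
    then show ?thesis by (cases k) (auto simp: algebra_simps)
  qed
  define e where "e = (real r)\<^sup>2 - real r - 1"
  have "real r * 2 \<le> real r * real r" using r by (intro mult_left_mono) auto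
  moreover have "real r \<ge> 2" using r by simp
  ultimately have e: "e \<ge> 0" unfolding e_def power2_eq_square by linarith
  have "real (card E2) * e \<le> real (card V) * (real (card V) - 1)"
    using E2_le unfolding choose2 e_def by (simp add: field_simps power2_eq_square)
  also have "\<dots> \<le> (real (card V))\<^sup>2" by (simp add: algebra_simps power2_eq_square)
  finally have "real (card E2) * e \<le> (real (card V))\<^sup>2" .
  moreover have "real (card E1) * e \<le> 2 * real (card V) * e"
    using E1_le e by (intro mult_right_mono) auto
  moreover have "card E = card E1 + card E2"
  proof -
    have "E1 \<subseteq> E" by (auto simp: E1_def)
    then show ?thesis
      unfolding E2_def using finE card_mono[of E E1] by (simp add: card_Diff_subset fin12)
  qed
  ultimately show ?thesis unfolding e_def[symmetric] by (simp add: algebra_simps)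
qed

section \<open>Lifting and blowing up\<close>

text \<open>Edges of different copies share at most one vertex, so two edges with two common
  vertices lie in one copy, and a third edge either lies there too or meets that copy in at most one
  vertex. The hypothesis \<open>sep\<close> compares an edge with a vertex set: the vertex sets of
  two copies may share more vertices, as long as no edge of either contains two of them.\<close>

lemma sparse_triples_lift:
  fixes \<psi> :: "'t \<Rightarrow> 'a \<Rightarrow> 'b"
  assumes unif: "uniform_hypergraph r X E" and sp: "sparse_triples E" and r: "r \<ge> 2"
    and fin: "finite X"
    and inj: "\<And>\<tau>. \<tau> \<in> T \<Longrightarrow> inj_on (\<psi> \<tau>) X"
    and sub: "\<And>\<tau>. \<tau> \<in> T \<Longrightarrow> \<psi> \<tau> ` X \<subseteq> V"
    and sep: "\<And>\<tau> \<tau>' F. \<tau> \<in> T \<Longrightarrow> \<tau>' \<in> T \<Longrightarrow> \<tau> \<noteq> \<tau>' \<Longrightarrow> F \<in> E \<Longrightarrow> card (\<psi> \<tau> ` F \<inter> \<psi> \<tau>' ` X) \<le> 1"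
  defines "E' \<equiv> (\<lambda>(\<tau>, F). \<psi> \<tau> ` F) ` (T \<times> E)"
  shows "uniform_hypergraph r V E'" "sparse_triples E'" "card E' = card T * card E"
proof -
  have EX: "F \<subseteq> X" "card F = r" if "F \<in> E" for F
    using unif that by (auto simp: uniform_hypergraph_def)
  have card_img: "card (\<psi> \<tau> ` S) = card S" if "\<tau> \<in> T" "S \<subseteq> X" for \<tau> S
    using inj that by (meson card_image inj_on_subset)
  have img_Int: "\<psi> \<tau> ` S \<inter> \<psi> \<tau> ` S' = \<psi> \<tau> ` (S \<inter> S')" if "\<tau> \<in> T" "S \<subseteq> X" "S' \<subseteq> X" for \<tau> S S'
    using inj that by (metis inj_on_image_Int)
  have sep': "card (\<psi> \<tau> ` F \<inter> Y) \<le> 1"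
    if "\<tau> \<in> T" "\<tau>' \<in> T" "\<tau> \<noteq> \<tau>'" "F \<in> E" "Y \<subseteq> \<psi> \<tau>' ` X" for \<tau> \<tau>' F Y
  proof -
    have "card (\<psi> \<tau> ` F \<inter> Y) \<le> card (\<psi> \<tau> ` F \<inter> \<psi> \<tau>' ` X)"
      using that fin by (intro card_mono) auto
    then show ?thesis using sep[of \<tau> \<tau>' F] that by linarith
  qed
  have E'E: "\<exists>\<tau> F. \<tau> \<in> T \<and> F \<in> E \<and> A = \<psi> \<tau> ` F" if "A \<in> E'" for A
    using that by (auto simp: E'_def)
  show "uniform_hypergraph r V E'"
    unfolding uniform_hypergraph_def
  proof
    fix A assume "A \<in> E'"
    then obtain \<tau> F where \<tau>: "\<tau> \<in> T" "F \<in> E" "A = \<psi> \<tau> ` F" using E'E by blast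
    then show "A \<subseteq> V \<and> card A = r" using card_img[of \<tau> F] EX[of F] sub[of \<tau>] by auto
  qed
  show "sparse_triples E'"
    unfolding sparse_triples_def
  proof (intro conjI ballI impI; (elim conjE)?)
    fix A B assume A: "A \<in> E'" and B: "B \<in> E'" and ne: "A \<noteq> B"
    obtain \<tau> F where \<tau>: "\<tau> \<in> T" "F \<in> E" "A = \<psi> \<tau> ` F" using E'E[OF A] by blast
    obtain \<tau>' G where \<tau>': "\<tau>' \<in> T" "G \<in> E" "B = \<psi> \<tau>' ` G" using E'E[OF B] by blast
    show "card (A \<inter> B) \<le> 2"
    proof (cases "\<tau> = \<tau>'")
      case True
      then have "card (A \<inter> B) = card (F \<inter> G)"
        using \<tau> \<tau>' EX img_Int[of \<tau> F G] card_img[of \<tau> "F \<inter> G"] by (simp add: le_infI1)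
      moreover have "F \<noteq> G" using ne True \<tau> \<tau>' by auto
      ultimately show ?thesis using sp \<tau> \<tau>' by (auto simp: sparse_triples_def)
    next
      case False
      have "B \<subseteq> \<psi> \<tau>' ` X" using \<tau>' EX by auto
      then have "card (A \<inter> B) \<le> 1" using sep'[of \<tau> \<tau>' F B] False \<tau> \<tau>' by simp
      then show ?thesis by simp
    qed
  next
    fix A B C assume A: "A \<in> E'" and B: "B \<in> E'" and C: "C \<in> E'"
      and ne: "A \<noteq> B" "C \<noteq> A" "C \<noteq> B" and two: "card (A \<inter> B) = 2"
    obtain \<tau> F where \<tau>: "\<tau> \<in> T" "F \<in> E" "A = \<psi> \<tau> ` F" using E'E[OF A] by blast
    obtain \<tau>' G where \<tau>': "\<tau>' \<in> T" "G \<in> E" "B = \<psi> \<tau>' ` G" using E'E[OF B] by blast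
    obtain \<tau>'' H where \<tau>'': "\<tau>'' \<in> T" "H \<in> E" "C = \<psi> \<tau>'' ` H" using E'E[OF C] by blast
    have "B \<subseteq> \<psi> \<tau>' ` X" using \<tau>' EX by auto
    then have eq: "\<tau>' = \<tau>" using sep'[of \<tau> \<tau>' F B] two \<tau> \<tau>' by fastforce
    have Un: "A \<union> B = \<psi> \<tau> ` (F \<union> G)" using \<tau> \<tau>' eq by auto
    show "card (C \<inter> (A \<union> B)) \<le> 1"
    proof (cases "\<tau>'' = \<tau>")
      case True
      have "card (F \<inter> G) = 2"
        using two \<tau> \<tau>' eq EX img_Int[of \<tau> F G] card_img[of \<tau> "F \<inter> G"] by (simp add: le_infI1)
      moreover have "F \<noteq> G" "H \<noteq> F" "H \<noteq> G" using ne \<tau> \<tau>' \<tau>'' eq True by auto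
      ultimately have "card (H \<inter> (F \<union> G)) \<le> 1"
        using sp \<tau> \<tau>' \<tau>'' unfolding sparse_triples_def by blast
      moreover have "C \<inter> (A \<union> B) = \<psi> \<tau> ` (H \<inter> (F \<union> G))"
        using img_Int[of \<tau> H "F \<union> G"] \<tau> \<tau>' \<tau>'' True EX unfolding Un by simp
      ultimately show ?thesis
        using card_img[of \<tau> "H \<inter> (F \<union> G)"] \<tau>(1) EX[OF \<tau>''(2)] by (simp add: le_infI1)
    next
      case False
      have "A \<union> B \<subseteq> \<psi> \<tau> ` X" unfolding Un using EX \<tau> \<tau>' by (intro image_mono) auto
      then show ?thesis using sep'[of \<tau>'' \<tau> H "A \<union> B"] False \<tau> \<tau>'' by simp
    qed
  qed
  have "inj_on (\<lambda>(\<tau>, F). \<psi> \<tau> ` F) (T \<times> E)"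
  proof (rule inj_onI, clarsimp)
    fix \<tau> F \<tau>' G
    assume \<tau>: "\<tau> \<in> T" "F \<in> E" and \<tau>': "\<tau>' \<in> T" "G \<in> E" and eq: "\<psi> \<tau> ` F = \<psi> \<tau>' ` G"
    \<comment> \<open>An edge common to two copies would have \<open>r \<ge> 2\<close> vertices in
      both.\<close>
    have "\<tau> = \<tau>'"
    proof (rule ccontr)
      assume "\<tau> \<noteq> \<tau>'"
      moreover have "\<psi> \<tau> ` F \<subseteq> \<psi> \<tau>' ` X" unfolding eq using EX \<tau>' by (intro image_mono)
      ultimately have "card (\<psi> \<tau> ` F) \<le> 1" using sep'[of \<tau> \<tau>' F "\<psi> \<tau> ` F"] \<tau> \<tau>' by simp
      then show False using card_img[of \<tau> F] EX[of F] \<tau> r by simp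
    qed
    then show "\<tau> = \<tau>' \<and> F = G"
      using eq inj_on_image_eq_iff[OF inj[OF \<tau>(1)], of F G] EX \<tau> \<tau>' by simp
  qed
  then show "card E' = card T * card E"
    unfolding E'_def by (simp add: card_image card_cartesian_product)
qed

text \<open>The blocks \<open>i \<mapsto> (i, a * i + b)\<close> of a transversal design pairwise meet in at most one point.\<close>

lemma sparse_triples_blow_up:
  fixes E :: "int set set"
  assumes unif: "uniform_hypergraph r {0..<int N} E" and sp: "sparse_triples E" and r: "r \<ge> 2"
    and m: "m > 0" and cop: "\<And>i. 0 < i \<Longrightarrow> i < N \<Longrightarrow> coprime i m"
  shows "\<exists>E' :: nat set set. uniform_hypergraph r {..<N * m} E' \<and> sparse_triples E'
    \<and> card E' = m\<^sup>2 * card E"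
proof -
  \<comment> \<open>Entry \<open>y\<close> of column \<open>i\<close> is coded as the number
    \<open>i * m + y\<close>, so \<open>div\<close> and \<open>mod\<close> by \<open>m\<close>
    recover column and entry.\<close>
  define h where "h = (\<lambda>(a, b) i. nat (i * int m + (a * i + b) mod int m))"
  define X where "X = {0..<int N}"
  define T where "T = {0..<int m} \<times> {0..<int m}"
  have mod_range: "0 \<le> x mod int m" "x mod int m < int m" for x using m by auto
  have h_int: "int (h (a, b) i) = i * int m + (a * i + b) mod int m" if "i \<in> X" for a b i
    using that mod_range by (auto simp: h_def X_def)
  have h_div: "int (h \<tau> i) div int m = i" if "i \<in> X" for \<tau> i
    using h_int[OF that, of "fst \<tau>" "snd \<tau>"] m by simp
  have h_mod: "int (h (a, b) i) mod int m = (a * i + b) mod int m" if "i \<in> X" for a b i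
    using h_int[OF that, of a b] by simp
  have inj: "inj_on (h \<tau>) X" for \<tau>
    by (rule inj_onI) (metis h_div)
  have sub: "h \<tau> ` X \<subseteq> {..<N * m}" for \<tau>
  proof safe
    fix i assume i: "i \<in> X"
    have "int (h \<tau> i) div int m < int N" using h_div[OF i] i by (simp add: X_def)
    then have "int (h \<tau> i) < int N * int m"
      using m by (metis div_less_iff_less_mult zdiv_int of_nat_0_less_iff of_nat_less_iff of_nat_mult)
    then show "h \<tau> i < N * m" by (simp only: of_nat_mult[symmetric] of_nat_less_iff)
  qed
  have dvd_imp_eq: "x = y" if "x \<in> {0..<int m}" "y \<in> {0..<int m}" "int m dvd x - y" for x y
    using that by (metis atLeastLessThan_iff cong_iff_dvd_diff cong_less_imp_eq_int)
  have meet: "i = j"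
    if \<tau>: "(a, b) \<in> T" "(a', b') \<in> T" "(a, b) \<noteq> (a', b')" and ij: "i \<in> X" "j \<in> X"
      and hi: "h (a, b) i = h (a', b') i" and hj: "h (a, b) j = h (a', b') j" for a b a' b' i j
  proof (rule ccontr)
    assume ne: "i \<noteq> j"
    have "[a * i + b = a' * i + b'] (mod int m)" "[a * j + b = a' * j + b'] (mod int m)"
      using h_mod[of i a b] h_mod[of i a' b'] h_mod[of j a b] h_mod[of j a' b'] hi hj ij
      by (simp_all add: cong_def)
    then have d: "int m dvd (a * i + b) - (a' * i + b')" "int m dvd (a * j + b) - (a' * j + b')"
      by (simp_all only: cong_iff_dvd_diff)
    then have "int m dvd ((a * i + b) - (a' * i + b')) - ((a * j + b) - (a' * j + b'))"
      by (rule dvd_diff)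
    moreover have "((a * i + b) - (a' * i + b')) - ((a * j + b) - (a' * j + b')) = (a - a') * (i - j)"
      by (simp add: algebra_simps)
    ultimately have "int m dvd (a - a') * (i - j)" by metis
    \<comment> \<open>Two columns differ by a nonzero number of absolute value below
      \<open>N\<close>, which is invertible modulo \<open>m\<close>; hence two common points
      determine the slope \<open>a\<close>, and then \<open>b\<close>.\<close>
    moreover have "coprime (int m) (i - j)"
    proof -
      have "coprime (nat \<bar>i - j\<bar>) m" using ne ij by (intro cop) (auto simp: X_def)
      then have "coprime (int (nat \<bar>i - j\<bar>)) (int m)" by (simp only: coprime_int_iff)
      then show ?thesis by (simp add: coprime_commute)
    qed
    ultimately have "int m dvd a - a'" by (simp add: coprime_dvd_mult_left_iff)
    then have aa: "a = a'" using dvd_imp_eq \<tau> by (auto simp: T_def)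
    then have "int m dvd b - b'" using d(1) by simp
    then have "b = b'" using dvd_imp_eq \<tau> by (auto simp: T_def)
    then show False using aa \<tau>(3) by simp
  qed
  have sep: "card (h \<tau> ` F \<inter> h \<tau>' ` X) \<le> 1" if "\<tau> \<in> T" "\<tau>' \<in> T" "\<tau> \<noteq> \<tau>'" "F \<in> E" for \<tau> \<tau>' F
  proof -
    have FX: "F \<subseteq> X" using unif that by (auto simp: uniform_hypergraph_def X_def)
    have fin: "finite (h \<tau> ` F \<inter> h \<tau>' ` X)" by (simp add: X_def)
    obtain a b a' b' where ab: "\<tau> = (a, b)" "\<tau>' = (a', b')" by fastforce
    have "\<forall>x\<in>h \<tau> ` F \<inter> h \<tau>' ` X. \<forall>y\<in>h \<tau> ` F \<inter> h \<tau>' ` X. x = y"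
    proof (intro ballI)
      fix x y assume xy: "x \<in> h \<tau> ` F \<inter> h \<tau>' ` X" "y \<in> h \<tau> ` F \<inter> h \<tau>' ` X"
      obtain i i' j j' where i: "x = h \<tau> i" "x = h \<tau>' i'" "i \<in> X" "i' \<in> X"
        and j: "y = h \<tau> j" "y = h \<tau>' j'" "j \<in> X" "j' \<in> X" using xy FX by blast
      have "i = i'" "j = j'" using i j h_div by metis+
      then have "i = j" using meet[of a b a' b' i j] i j that ab
        by metis
      then show "x = y" using i j by simp
    qed
    then show ?thesis by (simp only: card_le_Suc0_iff_eq[OF fin] One_nat_def)
  qed
  have "finite X" by (simp add: X_def)
  note lift = sparse_triples_lift[where \<psi> = h and T = T and V = "{..<N * m}", OF unif[folded X_def] sp r this inj sub sep]
  have "card T = m\<^sup>2" by (simp add: T_def card_cartesian_product power2_eq_square)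
  then show ?thesis using lift by (intro exI[of _ "(\<lambda>(\<tau>, F). h \<tau> ` F) ` (T \<times> E)"]) simp
qed

section \<open>Cyclotomic colourings of prime fields\<close>

lemma mod_in_nonzero_residues:
  fixes n x :: int
  assumes "0 < n" "\<not> n dvd x"
  shows "x mod n \<in> {1..<n}"
proof -
  have "x mod n \<noteq> 0" using assms by (simp add: dvd_eq_mod_eq_0)
  then show ?thesis
    using pos_mod_sign[OF assms(1), of x] pos_mod_bound[OF assms(1), of x] by auto
qed

section \<open>Suitable primes and discrete logarithms\<close>

text \<open>Euclid's argument with numbers of Fermat type: a prime divisor \<open>p\<close> of
  \<open>y ^ (2 ^ j) + 1\<close> sees \<open>y ^ (2 ^ j)\<close> as \<open>- 1\<close>, so
  \<open>y\<close> has order exactly \<open>2 ^ Suc j\<close> modulo \<open>p\<close>, and the order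
  divides \<open>p - 1\<close>.\<close>

lemma exists_prime_cong_1_mod_two_power:
  "\<exists>p>L. prime p \<and> 2 ^ Suc j dvd p - (1::nat)"
proof -
  \<comment> \<open>The factor 2 forces \<open>p\<close> to be odd and the factorial forces
    \<open>p > L\<close>, since \<open>p\<close> cannot divide \<open>y\<close>.\<close>
  define y where "y = (2 * fact L :: nat)"
  define z where "z = y ^ (2 ^ j)"
  have "z + 1 \<noteq> 1" by (simp add: z_def y_def)
  then obtain p where p: "prime p" "p dvd z + 1" using prime_factor_nat by blast
  have "\<not> p dvd z"
  proof
    assume "p dvd z"
    then have "p dvd z + 1 - z" using p(2) by (intro dvd_diff_nat)
    then show False using p(1) by simp
  qed
  then have py: "\<not> p dvd y" using p(1) by (simp add: z_def prime_dvd_power_iff)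
  then have "\<not> p dvd fact L" unfolding y_def using dvd_mult by blast
  then have "p > L" using p(1) by (simp add: prime_dvd_fact_iff)
  have "p \<noteq> 2" using py by (auto simp: y_def)
  have cop: "coprime p y" using p py by (simp add: prime_imp_coprime)
  have zz: "[int z = - 1] (mod int p)"
  proof -
    have "int p dvd int (z + 1)" using p(2) by (simp only: int_dvd_int_iff)
    then show ?thesis by (simp add: cong_iff_dvd_diff add.commute)
  qed
  then have "[int z * int z = - 1 * - 1] (mod int p)" by (intro cong_mult)
  then have "[int (y ^ 2 ^ Suc j) = int 1] (mod int p)"
    by (simp add: z_def power2_eq_square power_mult[symmetric] mult.commute power_add[symmetric] mult_2)
  then have "[y ^ 2 ^ Suc j = 1] (mod p)" by (simp only: cong_int_iff)
  then have "ord p y dvd 2 ^ Suc j" by (simp only: ord_divides)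
  then obtain i where i: "i \<le> Suc j" "ord p y = 2 ^ i"
    unfolding divides_primepow_nat[OF two_is_prime_nat] by blast
  \<comment> \<open>A smaller power of two would divide \<open>2 ^ j\<close>, whence
    \<open>z\<close> would be both \<open>1\<close> and \<open>- 1\<close> modulo the odd prime
    \<open>p\<close>.\<close>
  have "i = Suc j"
  proof (rule ccontr)
    assume "i \<noteq> Suc j"
    then have "ord p y dvd 2 ^ j" using i by (simp add: le_imp_power_dvd)
    then have "[z = 1] (mod p)" by (simp only: ord_divides z_def)
    then have "[int z = 1] (mod int p)" by (metis cong_int_iff of_nat_1)
    with zz have "[- 1 = (1::int)] (mod int p)" by (metis cong_sym cong_trans)
    then have "int p dvd 2" by (simp add: cong_iff_dvd_diff)
    then have "p dvd 2" by (metis int_dvd_int_iff of_nat_numeral)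
    then show False using \<open>p \<noteq> 2\<close> p(1) by (simp add: primes_dvd_imp_eq)
  qed
  then have "2 ^ Suc j dvd p - 1"
    using order_divides_totient[OF cop] i p(1) by (simp add: totient_prime)
  then show ?thesis using \<open>p > L\<close> p(1) by blast
qed

text \<open>\<open>ind\<close> is the index with respect to a primitive root, extended periodically
  to all integers; its value on multiples of \<open>p\<close> is left open.\<close>

locale discrete_log =
  fixes p :: nat and ind :: "int \<Rightarrow> nat"
  assumes prime_p: "prime p" and odd_p: "odd p"
    and ind_cong: "[x = y] (mod int p) \<Longrightarrow> ind x = ind y"
    and ind_mult: "\<not> int p dvd x \<Longrightarrow> \<not> int p dvd y \<Longrightarrow> [ind (x * y) = ind x + ind y] (mod p - 1)"
    and ind_bij: "bij_betw ind {1..<int p} {..<p - 1}"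

text \<open>For a primitive root \<open>g\<close>, invert the map from \<open>i\<close> to
  \<open>g ^ i mod p\<close>. Products become sums because the exponents of \<open>g\<close> matter
  only modulo \<open>ord p g = p - 1\<close>.\<close>

lemma discrete_log_exists:
  assumes p: "prime p" "odd p"
  shows "\<exists>ind. discrete_log p ind"
proof -
  obtain g where g: "residue_primroot p g" using prime_primitive_root_exists[of p] p(1)
    prime_gt_1_nat by blast
  have p1: "p > 1" using p(1) prime_gt_1_nat by blast
  have tot: "totatives p = {1..<p}"
    using p(1) by (auto simp: totatives_prime)
  have ordg: "ord p g = p - 1" "coprime p g"
    using g p(1) by (auto simp: residue_primroot_def totient_prime)
  define h where "h i = g ^ i mod p" for i
  have h: "bij_betw h {..<p - 1} {1..<p}"
    using residue_primroot_is_generator[OF p1 g] p(1) tot unfolding h_def by (simp add: totient_prime)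
  define ind0 where "ind0 = inv_into {..<p - 1} h"
  have ind0: "bij_betw ind0 {1..<p} {..<p - 1}"
    using bij_betw_inv_into[OF h] by (simp add: ind0_def)
  have h_ind0: "h (ind0 x) = x" if "x \<in> {1..<p}" for x
    using h that by (simp add: ind0_def bij_betw_inv_into_right)
  define ind where "ind x = ind0 (nat (x mod int p))" for x
  have res: "nat (x mod int p) \<in> {1..<p}" if "\<not> int p dvd x" for x
    using mod_in_nonzero_residues[of "int p" x] that p1 by (auto simp: nat_less_iff)
  have pow: "[int g ^ ind x = x] (mod int p)" if "\<not> int p dvd x" for x
  proof -
    have "g ^ ind x mod p = nat (x mod int p)"
      using h_ind0[OF res[OF that]] by (simp add: ind_def h_def)
    then have "int (g ^ ind x mod p) = x mod int p" using p1 by simp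
    then show ?thesis by (simp add: cong_def zmod_int)
  qed
  have "discrete_log p ind"
  proof
    show "prime p" "odd p" by fact+
    show "ind x = ind y" if "[x = y] (mod int p)" for x y
      using that by (simp add: ind_def cong_def)
    show "[ind (x * y) = ind x + ind y] (mod p - 1)" if "\<not> int p dvd x" "\<not> int p dvd y" for x y
    proof -
      have "\<not> int p dvd x * y" using that p(1) by (simp add: prime_dvd_mult_iff)
      then have "[int g ^ ind (x * y) = x * y] (mod int p)" by (rule pow)
      also have "[x * y = int g ^ ind x * int g ^ ind y] (mod int p)"
        using that by (intro cong_mult cong_sym[OF pow])
      finally have "[int (g ^ ind (x * y)) = int (g ^ (ind x + ind y))] (mod int p)"
        by (simp add: power_add)
      then have "[g ^ ind (x * y) = g ^ (ind x + ind y)] (mod p)" by (simp only: cong_int_iff)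
      then show ?thesis using order_divides_expdiff[OF ordg(2)] ordg(1) by simp
    qed
    have "bij_betw nat {1..<int p} {1..<p}"
      by (rule bij_betw_byWitness[where f' = int]) auto
    then have "bij_betw (ind0 \<circ> nat) {1..<int p} {..<p - 1}"
      using ind0 by (rule bij_betw_trans)
    moreover have "ind x = (ind0 \<circ> nat) x" if "x \<in> {1..<int p}" for x
      using that by (simp add: ind_def)
    ultimately show "bij_betw ind {1..<int p} {..<p - 1}"
      using bij_betw_cong[of "{1..<int p}" ind "ind0 \<circ> nat"] by blast
  qed
  then show ?thesis by blast
qed

section \<open>Colour classes as cosets of the subgroup of index M\<close>

text \<open>The factor 2 in \<open>p_eq\<close> makes the index \<open>M * q\<close> of
  \<open>- 1\<close> a multiple of \<open>M\<close>. So \<open>- 1\<close> has colour 0 and the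
  colour of a difference does not depend on its orientation.\<close>

locale cyclotomic_colouring = discrete_log +
  fixes M q :: nat
  assumes p_eq: "p = 2 * M * q + 1"
begin

definition col :: "int \<Rightarrow> nat" where "col x = ind x mod M"

lemma p_gt: "p > 2"
  using prime_p odd_p prime_gt_1_nat[of p] by (cases "p = 2") auto

lemma M_pos: "M > 0"
  using p_eq p_gt by (auto intro: Nat.gr0I)

lemma ind_less: "\<not> int p dvd x \<Longrightarrow> ind x < p - 1"
proof -
  assume x: "\<not> int p dvd x"
  then have "x mod int p \<in> {1..<int p}"
    using mod_in_nonzero_residues[of "int p" x] p_gt by simp
  then have "ind (x mod int p) \<in> {..<p - 1}" using ind_bij by (metis bij_betwE)
  moreover have "ind (x mod int p) = ind x" by (rule ind_cong) (simp add: cong_def)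
  ultimately show ?thesis by simp
qed

lemma ind_inj:
  assumes "\<not> int p dvd x" "\<not> int p dvd y" "ind x = ind y"
  shows "[x = y] (mod int p)"
proof -
  have range: "z mod int p \<in> {1..<int p}" if "\<not> int p dvd z" for z
    using mod_in_nonzero_residues[of "int p" z] p_gt that by simp
  have "ind (x mod int p) = ind (y mod int p)"
    using assms(3) ind_cong[of "x mod int p" x] ind_cong[of "y mod int p" y] by (simp add: cong_def)
  then have "x mod int p = y mod int p"
    using ind_bij range assms by (metis bij_betw_imp_inj_on inj_onD)
  then show ?thesis by (simp add: cong_def)
qed

lemma not_dvd_one: "\<not> int p dvd 1" "\<not> int p dvd - 1"
  using p_gt by auto

lemma ind_one: "ind 1 = 0"
proof -
  have "[ind 1 + ind 1 = ind 1 + 0] (mod p - 1)"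
    using ind_mult[of 1 1] not_dvd_one by (simp add: cong_sym)
  then have "[ind 1 = 0] (mod p - 1)" by (simp only: cong_add_lcancel_nat)
  then show ?thesis using ind_less[OF not_dvd_one(1)] by (simp add: cong_def)
qed

text \<open>Twice the index vanishes modulo \<open>p - 1 = 2 * M * q\<close>, which leaves
  \<open>0\<close> and \<open>M * q\<close>; the index \<open>0\<close> belongs to
  \<open>1\<close>.\<close>

lemma ind_minus_one: "ind (- 1) = M * q"
proof -
  have "[ind (- 1) + ind (- 1) = 0] (mod p - 1)"
    using ind_mult[of "- 1" "- 1"] not_dvd_one ind_one by (simp add: cong_sym)
  then have "p - 1 dvd 2 * ind (- 1)" by (simp add: cong_0_iff mult_2)
  moreover have "p - 1 = 2 * M * q" using p_eq by simp
  ultimately have "2 * M * q dvd 2 * ind (- 1)" by metis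
  then have "M * q dvd ind (- 1)" by (simp add: mult.assoc)
  then obtain l where l: "ind (- 1) = M * q * l" by (auto simp: dvd_def)
  have "ind (- 1) < M * q * 2" using ind_less[OF not_dvd_one(2)] p_eq by simp
  then have "l < 2" using l by simp
  moreover have "l \<noteq> 0"
  proof
    assume "l = 0"
    then have "[1 = - 1] (mod int p)" using ind_inj[OF not_dvd_one] l ind_one by simp
    then have "int p dvd 2" by (simp add: cong_iff_dvd_diff)
    then show False using p_gt zdvd_imp_le[of "int p" 2] by simp
  qed
  ultimately have "l = 1" by simp
  then show ?thesis using l by simp
qed

lemma col_less: "col x < M"
  using M_pos by (simp add: col_def)

lemma col_cong: "[x = y] (mod int p) \<Longrightarrow> col x = col y"
  unfolding col_def using ind_cong by metis

lemma col_mult: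
  assumes "\<not> int p dvd x" "\<not> int p dvd y"
  shows "col (x * y) = (col x + col y) mod M"
proof -
  have "[ind (x * y) = ind x + ind y] (mod M)"
    by (rule cong_dvd_modulus_nat[OF ind_mult[OF assms]]) (simp add: p_eq)
  then show ?thesis by (simp add: col_def cong_def mod_add_eq)
qed

lemma col_uminus: "col (- x) = col x"
proof (cases "int p dvd x")
  case True
  then show ?thesis by (intro col_cong) (simp add: cong_iff_dvd_diff)
next
  case False
  then show ?thesis
    using col_mult[OF not_dvd_one(2) False] by (simp add: col_def ind_minus_one)
qed

lemma card_ind_Collect: "card {x \<in> {1..<int p}. P (ind x)} = card {i. i < p - 1 \<and> P i}"
proof -
  have "inj_on ind {x \<in> {1..<int p}. P (ind x)}"
    using ind_bij by (auto simp: bij_betw_def intro: inj_on_subset)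
  moreover have "ind ` {x \<in> {1..<int p}. P (ind x)} = {i \<in> ind ` {1..<int p}. P i}"
    by blast
  moreover have "\<dots> = {i. i < p - 1 \<and> P i}"
    using ind_bij by (simp add: bij_betw_def)
  ultimately show ?thesis by (metis card_image)
qed

lemma card_multiples_less: "card {i. i < M * l \<and> i mod M = 0} = l"
proof -
  have "{i. i < M * l \<and> i mod M = 0} = (\<lambda>j. M * j) ` {..<l}"
    using M_pos by (auto simp: image_iff)
  then show ?thesis using M_pos by (simp add: card_image inj_on_def)
qed

lemma card_col_zero: "card {x \<in> {1..<int p}. col x = 0} = 2 * q"
  using card_ind_Collect[of "\<lambda>i. i mod M = 0"] card_multiples_less[of "2 * q"] p_eq
  by (simp add: col_def mult.commute mult.left_commute)

text \<open>Scaling a gadget by \<open>x\<close> or by \<open>- x\<close> yields the same differences up to sign, so only one of the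
  two scalings is used.\<close>

definition half_class :: "int set" where
  "half_class = {x \<in> {1..<int p}. col x = 0 \<and> ind x < M * q}"

lemma card_half_class: "card half_class = q"
proof -
  have "{i. i < p - 1 \<and> (i mod M = 0 \<and> i < M * q)} = {i. i < M * q \<and> i mod M = 0}"
  proof -
    have "M * q \<le> p - 1" using p_eq by simp
    then show ?thesis by auto
  qed
  then show ?thesis
    using card_ind_Collect[of "\<lambda>i. i mod M = 0 \<and> i < M * q"] card_multiples_less[of q]
    by (simp add: half_class_def col_def)
qed

lemma half_class_not_dvd: "x \<in> half_class \<Longrightarrow> \<not> int p dvd x"
  by (auto simp: half_class_def dest: zdvd_imp_le)

text \<open>Negation shifts the index by \<open>M * q\<close>, from the lower half of the range into
  the upper half.\<close>

lemma half_class_unique: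
  assumes "x \<in> half_class" "y \<in> half_class" "[x = y] (mod int p) \<or> [x = - y] (mod int p)"
  shows "x = y"
  using assms(3)
proof
  assume "[x = y] (mod int p)"
  then show ?thesis using assms by (auto simp: half_class_def cong_def)
next
  assume "[x = - y] (mod int p)"
  then have "ind x = ind (- 1 * y)" using ind_cong by simp
  then have "[ind x = M * q + ind y] (mod p - 1)"
    using ind_mult[OF not_dvd_one(2) half_class_not_dvd[OF assms(2)]] ind_minus_one by simp
  \<comment> \<open>Both sides of the congruence lie below \<open>p - 1\<close>, so there is no
    wraparound and it is an equality.\<close>
  moreover have "M * q + M * q = p - 1" using p_eq by simp
  then have "ind x < p - 1" "M * q + ind y < p - 1"
    using assms(1,2) by (auto simp: half_class_def)
  ultimately have "ind x = M * q + ind y" by (simp add: cong_def)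
  then show ?thesis using assms(1) by (simp add: half_class_def)
qed

end

section \<open>Equidistribution of colours by a second moment\<close>

context cyclotomic_colouring
begin

abbreviation residues :: "int set" where "residues \<equiv> {0..<int p}"

lemma residue_eqI:
  assumes "x \<in> residues" "y \<in> residues" "int p dvd x - y"
  shows "x = y"
  using assms by (metis atLeastLessThan_iff cong_iff_dvd_diff cong_less_imp_eq_int)

text \<open>The ratio \<open>x\<close> of \<open>v - w\<close> to \<open>v - w'\<close> modulo
  \<open>p\<close> has colour 0 when both differences have the same colour. As a Moebius function of
  \<open>v\<close> it is injective, and there are \<open>2 * q\<close> values of colour 0.\<close>

lemma card_equal_col_le:
  assumes w: "w \<in> residues" and w': "w' \<in> residues" and ne: "w \<noteq> w'"
  shows "card {v \<in> residues. w \<noteq> v \<and> w' \<noteq> v \<and> col (v - w) = col (v - w')} \<le> 2 * q"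
  unfolding card_col_zero[symmetric]
proof (rule card_le_if_inj_on_rel[where r = "\<lambda>v x. [x * (v - w') = v - w] (mod int p)"])
  show "finite {x \<in> {1..<int p}. col x = 0}"
    by (rule finite_subset[of _ "{1..<int p}"]) auto
next
  fix v assume "v \<in> {v \<in> residues. w \<noteq> v \<and> w' \<noteq> v \<and> col (v - w) = col (v - w')}"
  then have v: "v \<in> residues" "w \<noteq> v" "w' \<noteq> v" "col (v - w) = col (v - w')" by auto
  have nd: "\<not> int p dvd v - w" "\<not> int p dvd v - w'"
    using residue_eqI v w w' by metis+
  have "coprime (v - w') (int p)"
    using prime_p nd(2) by (metis coprime_commute prime_imp_coprime prime_int_nat_transfer nat_int of_nat_0_le_iff)
  then obtain y where y: "[(v - w') * y = 1] (mod int p)"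
    using cong_solve_coprime_int by blast
  define x where "x = (y * (v - w)) mod int p"
  have xc: "[x = y * (v - w)] (mod int p)" by (simp add: x_def cong_def)
  have "[x * (v - w') = y * (v - w) * (v - w')] (mod int p)"
    using xc by (rule cong_scalar_right)
  also have "y * (v - w) * (v - w') = (v - w') * y * (v - w)" by (simp add: algebra_simps)
  also have "[(v - w') * y * (v - w) = 1 * (v - w)] (mod int p)"
    using y by (rule cong_scalar_right)
  finally have rel: "[x * (v - w') = v - w] (mod int p)" by simp
  then have ndx: "\<not> int p dvd x" using nd by (metis cong_dvd_iff dvd_mult2)
  then have xr: "x \<in> {1..<int p}"
    using mod_in_nonzero_residues[of "int p" x] p_gt by (simp add: x_def)
  have "col (v - w) = (col x + col (v - w')) mod M"
    using col_cong[OF rel] col_mult[OF ndx nd(2)] by simp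
  then have "(col x + col (v - w)) mod M = col (v - w)" using v(4) by simp
  then have "[col x + col (v - w) = 0 + col (v - w)] (mod M)"
    using col_less[of "v - w"] by (simp add: cong_def)
  then have "[col x = 0] (mod M)" by (simp only: cong_add_rcancel_nat)
  then have "col x = 0" using col_less[of x] by (simp add: cong_def)
  then show "\<exists>x. x \<in> {x \<in> {1..<int p}. col x = 0} \<and> [x * (v - w') = v - w] (mod int p)"
    using xr rel by blast
next
  fix v1 v2 x
  assume v1: "v1 \<in> {v \<in> residues. w \<noteq> v \<and> w' \<noteq> v \<and> col (v - w) = col (v - w')}"
    and v2: "v2 \<in> {v \<in> residues. w \<noteq> v \<and> w' \<noteq> v \<and> col (v - w) = col (v - w')}"
    and r1: "[x * (v1 - w') = v1 - w] (mod int p)"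
    and r2: "[x * (v2 - w') = v2 - w] (mod int p)"
  have "[x * (v1 - w') - x * (v2 - w') = v1 - w - (v2 - w)] (mod int p)"
    using r1 r2 by (rule cong_diff)
  moreover have "x * (v1 - w') - x * (v2 - w') - (v1 - w - (v2 - w)) = (x - 1) * (v1 - v2)"
    by (simp add: algebra_simps)
  ultimately have "int p dvd (x - 1) * (v1 - v2)" by (simp only: cong_iff_dvd_diff)
  then have "int p dvd x - 1 \<or> int p dvd v1 - v2" using prime_p by (simp add: prime_dvd_mult_iff)
  then show "v1 = v2"
  proof
    \<comment> \<open>Ratio 1 would mean that \<open>w\<close> and \<open>w'\<close>
      coincide.\<close>
    assume x: "int p dvd x - 1"
    have "int p dvd x * (v1 - w') - (v1 - w)" using r1 by (simp only: cong_iff_dvd_diff)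
    moreover have "int p dvd (x - 1) * (v1 - w')" using x by simp
    ultimately have "int p dvd x * (v1 - w') - (v1 - w) - (x - 1) * (v1 - w')" by (rule dvd_diff)
    moreover have "x * (v1 - w') - (v1 - w) - (x - 1) * (v1 - w') = w - w'"
      by (simp add: algebra_simps)
    ultimately show ?thesis using residue_eqI w w' ne by metis
  next
    assume "int p dvd v1 - v2"
    then show ?thesis using residue_eqI v1 v2 by blast
  qed
qed

text \<open>Counting equally coloured pairs summed over all colours at once avoids cyclotomic numbers:
  two differences have equal colour iff their ratio lies in the subgroup of index \<open>M\<close>.\<close>

lemma second_moment:
  fixes W :: "int set"
  assumes W: "W \<subseteq> residues"
  defines "n \<equiv> \<lambda>v c. real (card {w \<in> W. w \<noteq> v \<and> col (v - w) = c})"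
  shows "(\<Sum>v\<in>residues. \<Sum>c<M. (n v c - real (card W) / real M)\<^sup>2) \<le> 2 * real p * real (card W)"
proof -
  have finW: "finite W" using W finite_subset by blast
  define I where "I c v w = (of_bool (w \<noteq> v \<and> col (v - w) = c) :: real)" for c v w
  have n: "n v c = (\<Sum>w\<in>W. I c v w)" for v c
    using finW by (simp add: n_def I_def Int_def)
  have sum_I: "(\<Sum>c<M. I c v w) = of_bool (w \<noteq> v)" for v w
    using col_less[of "v - w"] by (simp add: I_def of_bool_conj sum_distrib_left[symmetric] of_bool_def)
  \<comment> \<open>Only the colour \<open>c = col (v - w)\<close> can contribute, so the sum over
    all colours just tests equality of the two colours.\<close>
  have sum_II: "(\<Sum>c<M. I c v w * I c v w') =
      of_bool (w \<noteq> v \<and> w' \<noteq> v \<and> col (v - w) = col (v - w'))" for v w w'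
  proof -
    have "(\<Sum>c<M. I c v w * I c v w') =
      (\<Sum>c<M. if c = col (v - w) then of_bool (w \<noteq> v \<and> w' \<noteq> v \<and> col (v - w) = col (v - w')) else 0)"
      by (intro sum.cong) (auto simp: I_def)
    then show ?thesis using col_less[of "v - w"] by simp
  qed
  have first: "(\<Sum>v\<in>residues. \<Sum>c<M. n v c) = real (card W) * (real p - 1)"
  proof -
    have "(\<Sum>v\<in>residues. \<Sum>c<M. n v c) = (\<Sum>v\<in>residues. \<Sum>w\<in>W. \<Sum>c<M. I c v w)"
      unfolding n by (intro sum.cong refl sum.swap)
    also have "\<dots> = (\<Sum>w\<in>W. \<Sum>v\<in>residues. of_bool (w \<noteq> v))"
      unfolding sum_I by (rule sum.swap)
    also have "\<dots> = (\<Sum>w\<in>W. real p - 1)"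
    proof (rule sum.cong[OF refl])
      fix w assume "w \<in> W"
      then have "card (residues - {w}) = p - 1" using W by (subst card_Diff_singleton) auto
      moreover have "{v \<in> residues. w \<noteq> v} = residues - {w}" by auto
      ultimately show "(\<Sum>v\<in>residues. of_bool (w \<noteq> v)) = real p - 1"
        using p_gt by (simp add: Int_def of_nat_diff)
    qed
    finally show ?thesis by simp
  qed
  have pair: "(\<Sum>v\<in>residues. \<Sum>c<M. I c v w * I c v w') \<le> (if w = w' then real p else 0) + 2 * real q"
    if "w \<in> W" "w' \<in> W" for w w'
  proof -
    have "(\<Sum>v\<in>residues. \<Sum>c<M. I c v w * I c v w')
        = real (card {v \<in> residues. w \<noteq> v \<and> w' \<noteq> v \<and> col (v - w) = col (v - w')})"
      unfolding sum_II by (simp add: Int_def)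
    moreover have "card {v \<in> residues. w \<noteq> v \<and> w' \<noteq> v \<and> col (v - w) = col (v - w')}
        \<le> (if w = w' then p else 0) + 2 * q"
    proof (cases "w = w'")
      case True
      have "card {v \<in> residues. w \<noteq> v \<and> w' \<noteq> v \<and> col (v - w) = col (v - w')} \<le> card residues"
        by (intro card_mono) auto
      then show ?thesis using True by simp
    next
      case False
      moreover have "w \<in> residues" "w' \<in> residues" using that W by blast+
      ultimately show ?thesis using card_equal_col_le[of w w'] by simp
    qed
    then have "real (card {v \<in> residues. w \<noteq> v \<and> w' \<noteq> v \<and> col (v - w) = col (v - w')})
        \<le> real ((if w = w' then p else 0) + 2 * q)"
      by (simp only: of_nat_le_iff)
    ultimately show ?thesis by (simp split: if_splits)
  qed
  have "(\<Sum>v\<in>residues. \<Sum>c<M. (n v c)\<^sup>2)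
      = (\<Sum>v\<in>residues. \<Sum>c<M. \<Sum>w\<in>W. \<Sum>w'\<in>W. I c v w * I c v w')"
    unfolding n power2_eq_square sum_product ..
  also have "\<dots> = (\<Sum>v\<in>residues. \<Sum>w\<in>W. \<Sum>w'\<in>W. \<Sum>c<M. I c v w * I c v w')"
    by (rule sum.cong[OF refl], rule trans[OF sum.swap], rule sum.cong[OF refl], rule sum.swap)
  also have "\<dots> = (\<Sum>w\<in>W. \<Sum>w'\<in>W. \<Sum>v\<in>residues. \<Sum>c<M. I c v w * I c v w')"
    by (rule trans[OF sum.swap], rule sum.cong[OF refl], rule sum.swap)
  also have "\<dots> \<le> (\<Sum>w\<in>W. \<Sum>w'\<in>W. (if w = w' then real p else 0) + 2 * real q)"
    by (intro sum_mono pair)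
  also have "\<dots> = real (card W) * real p + (real (card W))\<^sup>2 * (2 * real q)"
    using finW by (simp add: sum.distrib power2_eq_square algebra_simps)
  finally have second: "(\<Sum>v\<in>residues. \<Sum>c<M. (n v c)\<^sup>2)
    \<le> real (card W) * real p + (real (card W))\<^sup>2 * (2 * real q)" .
  define a where "a = real (card W) / real M"
  have Wp: "card W \<le> p" using card_mono[OF _ W] by simp
  have M: "real M > 0" using M_pos by simp
  have aM: "real (card W) = a * real M" using M by (simp add: a_def)
  have pr: "real p = 2 * real M * real q + 1"
    by (subst p_eq) simp
  have "(\<Sum>v\<in>residues. \<Sum>c<M. (n v c - a)\<^sup>2)
      = (\<Sum>v\<in>residues. \<Sum>c<M. (n v c)\<^sup>2 - 2 * a * n v c + a\<^sup>2)"
    by (simp add: power2_diff algebra_simps)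
  also have "\<dots> = (\<Sum>v\<in>residues. \<Sum>c<M. (n v c)\<^sup>2) - 2 * a * (\<Sum>v\<in>residues. \<Sum>c<M. n v c)
      + real p * real M * a\<^sup>2"
    by (simp add: sum.distrib sum_subtractf sum_distrib_left)
  also have "\<dots> \<le> real (card W) * real p + (real (card W))\<^sup>2 * (2 * real q)
      - 2 * a * (real (card W) * (real p - 1)) + real p * real M * a\<^sup>2"
    using second first by simp
  \<comment> \<open>With \<open>card W = a * M\<close> and \<open>2 * M * q = p - 1\<close> the main
    terms of size \<open>p * M * a\<^sup>2\<close> cancel, leaving
    \<open>M * a\<^sup>2 = card W * a\<close>.\<close>
  also have "\<dots> = real (card W) * real p + real (card W) * a"
    unfolding aM pr by (simp add: algebra_simps power2_eq_square)
  also have "\<dots> \<le> real (card W) * real p + real (card W) * real p"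
  proof -
    have "a \<le> real (card W) / 1" unfolding a_def using M_pos by (intro divide_left_mono) auto
    then have "a \<le> real p" using Wp by simp
    then show ?thesis by (intro add_left_mono mult_left_mono) auto
  qed
  finally show ?thesis by (simp add: a_def)
qed

text \<open>Chebyshev's inequality: with \<open>a = card W / M\<close>, each vertex counted here
  deviates from the mean \<open>a\<close> by at least \<open>a / 2\<close>, and the squared
  deviations sum to at most \<open>2 * p * card W\<close>.\<close>

lemma few_bad_vertices:
  assumes W: "W \<subseteq> residues" and c: "c < M"
  shows "card {v \<in> residues. 2 * M * card {w \<in> W. w \<noteq> v \<and> col (v - w) = c} < card W} * card W
    \<le> 8 * M\<^sup>2 * p"
proof (cases "card W = 0")
  case True
  then show ?thesis by simp
next
  case False
  define n where "n v c = real (card {w \<in> W. w \<noteq> v \<and> col (v - w) = c})" for v c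
  define X where "X = {v \<in> residues. 2 * M * card {w \<in> W. w \<noteq> v \<and> col (v - w) = c} < card W}"
  define a where "a = real (card W) / real M"
  have M: "real M > 0" using M_pos by simp
  have a: "a > 0" using False M by (simp add: a_def)
  have bad: "(a / 2)\<^sup>2 \<le> (n v c - a)\<^sup>2" if "v \<in> X" for v
  proof -
    have "real (2 * M * card {w \<in> W. w \<noteq> v \<and> col (v - w) = c}) < real (card W)"
      using that unfolding X_def by (simp only: of_nat_less_iff mem_Collect_eq)
    then have "n v c < a / 2" using M by (simp add: n_def a_def field_simps)
    then have "a / 2 \<le> a - n v c" by simp
    then have "(a / 2)\<^sup>2 \<le> (a - n v c)\<^sup>2" using a by (intro power_mono) auto
    then show ?thesis by (simp add: power2_commute)
  qed
  have "real (card X) * (a / 2)\<^sup>2 \<le> (\<Sum>v\<in>X. (n v c - a)\<^sup>2)"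
    using sum_mono[of X "\<lambda>_. (a / 2)\<^sup>2", OF bad] by simp
  also have "\<dots> \<le> (\<Sum>v\<in>residues. (n v c - a)\<^sup>2)"
    by (intro sum_mono2) (auto simp: X_def)
  also have "\<dots> \<le> (\<Sum>v\<in>residues. \<Sum>c<M. (n v c - a)\<^sup>2)"
    using c by (intro sum_mono member_le_sum) auto
  also have "\<dots> \<le> 2 * real p * real (card W)"
    using second_moment[OF W] by (simp add: n_def a_def)
  finally have "real (card X) * (a / 2)\<^sup>2 \<le> 2 * real p * real (card W)" .
  then have "real (card X) * real (card W) \<le> 8 * (real M)\<^sup>2 * real p"
    using M False by (simp add: a_def field_simps power2_eq_square)
  then have "real (card X * card W) \<le> real (8 * M\<^sup>2 * p)" by simp
  then show ?thesis unfolding X_def by (simp only: of_nat_le_iff)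
qed

end

section \<open>Finding coloured cliques\<close>

text \<open>A vertex is bad for \<open>U\<close> and \<open>x\<close> if it has fewer than half of the expected
  \<open>card U / M\<close> neighbours of colour \<open>x\<close> in \<open>U\<close>.\<close>

definition few_bad :: "nat \<Rightarrow> nat \<Rightarrow> 'a set \<Rightarrow> ('a \<Rightarrow> 'a \<Rightarrow> nat) \<Rightarrow> bool" where
  "few_bad C M V \<chi> \<longleftrightarrow> (\<forall>U\<subseteq>V. \<forall>x<M.
    card {v \<in> V. 2 * M * card {w \<in> U. w \<noteq> v \<and> \<chi> v w = x} < card U} * card U \<le> C * card V)"

text \<open>Induction on \<open>k\<close>, choosing the last vertex first: take \<open>v\<close> in
  \<open>W k\<close> that is bad for no other candidate set, and shrink each \<open>W i\<close> to
  its neighbours of the prescribed colour. Each set keeps a proportion \<open>1 / (2 * M)\<close>,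
  so the density parameter \<open>D\<close> grows to \<open>D * (2 * M)\<close>. The threshold
  \<open>N\<close> is uniform in the colouring, the candidate sets and the prescribed
  colours.\<close>

lemma coloured_clique_exists:
  fixes C M D k :: nat
  shows "\<exists>N. \<forall>(V :: 'a set) \<chi> W (c :: nat \<Rightarrow> nat \<Rightarrow> nat).
    finite V \<and> N \<le> card V \<and>
    few_bad C M V \<chi> \<and>
    (\<forall>i<k. W i \<subseteq> V \<and> card V \<le> D * card (W i)) \<and> (\<forall>i j. c i j < M)
    \<longrightarrow> (\<exists>\<phi>. \<forall>j<k. \<phi> j \<in> W j \<and> (\<forall>i<j. \<phi> i \<noteq> \<phi> j \<and> \<chi> (\<phi> j) (\<phi> i) = c i j))"
proof (induction k arbitrary: D)
  case 0
  show ?case by simp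
next
  case (Suc k)
  from Suc.IH[of "D * (2 * M)"]
  obtain N where N: "\<forall>(V :: 'a set) \<chi> W (c :: nat \<Rightarrow> nat \<Rightarrow> nat).
    finite V \<and> N \<le> card V \<and> few_bad C M V \<chi> \<and>
    (\<forall>i<k. W i \<subseteq> V \<and> card V \<le> D * (2 * M) * card (W i)) \<and> (\<forall>i j. c i j < M)
    \<longrightarrow> (\<exists>\<phi>. \<forall>j<k. \<phi> j \<in> W j \<and> (\<forall>i<j. \<phi> i \<noteq> \<phi> j \<and> \<chi> (\<phi> j) (\<phi> i) = c i j))"
    by (rule exE)
  show ?case
  \<comment> \<open>At most \<open>k * (C * D)\<close> vertices are bad for one of the
    \<open>k\<close> sets, while \<open>W k\<close> has at least \<open>card V / D\<close>. The
    summand 1 makes the comparison strict and keeps the candidate sets nonempty.\<close>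
  proof (intro exI[of _ "max N (D * (k * (C * D)) + 1)"] allI impI, elim conjE)
    fix V :: "'a set" and \<chi> W and c :: "nat \<Rightarrow> nat \<Rightarrow> nat"
    assume V: "finite V" and big: "max N (D * (k * (C * D)) + 1) \<le> card V"
      and few: "few_bad C M V \<chi>"
      and W: "\<forall>i<Suc k. W i \<subseteq> V \<and> card V \<le> D * card (W i)"
      and c: "\<forall>i j. c i j < M"
    define bad where "bad i = {v \<in> V. 2 * M * card {w \<in> W i. w \<noteq> v \<and> \<chi> v w = c i k} < card (W i)}" for i
    have bad_le: "card (bad i) \<le> C * D" if i: "i < k" for i
    proof -
      have Wi: "W i \<subseteq> V" "card V \<le> D * card (W i)" using W i by auto
      have "card (bad i) * card (W i) \<le> C * card V"
        using few Wi c by (simp add: bad_def few_bad_def)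
      also have "\<dots> \<le> C * (D * card (W i))" using Wi by (intro mult_left_mono) auto
      finally have "card (bad i) * card (W i) \<le> (C * D) * card (W i)" by (simp add: mult.assoc)
      moreover have "card (W i) > 0" using Wi big by (auto intro: Nat.gr0I)
      ultimately show ?thesis by simp
    qed
    have "card (\<Union>i<k. bad i) \<le> (\<Sum>i<k. card (bad i))" by (intro card_UN_le) auto
    also have "\<dots> \<le> (\<Sum>i<k. C * D)" using bad_le by (intro sum_mono) auto
    also have "\<dots> < card (W k)"
    proof (rule ccontr)
      assume "\<not> ?thesis"
      then have "D * card (W k) \<le> D * (k * (C * D))" by (intro mult_left_mono) auto
      moreover have "card V \<le> D * card (W k)" using W by simp
      ultimately have "card V \<le> D * (k * (C * D))" by linarith
      then show False using big by simp
    qed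
    finally have "card (\<Union>i<k. bad i) < card (W k)" .
    moreover have "finite (\<Union>i<k. bad i)" using V by (auto simp: bad_def)
    ultimately have "\<not> W k \<subseteq> (\<Union>i<k. bad i)" using card_mono leD by blast
    then obtain v where v: "v \<in> W k" "\<And>i. i < k \<Longrightarrow> v \<notin> bad i" by blast
    have vV: "v \<in> V" using v W by auto
    define W' where "W' i = {w \<in> W i. w \<noteq> v \<and> \<chi> v w = c i k}" for i
    have W': "W' i \<subseteq> V \<and> card V \<le> (D * (2 * M)) * card (W' i)" if i: "i < k" for i
    proof -
      have Wi: "W i \<subseteq> V" "card V \<le> D * card (W i)" using W i by auto
      have "card (W i) \<le> 2 * M * card (W' i)" using v(2)[OF i] vV by (simp add: bad_def W'_def)
      then have "D * card (W i) \<le> D * (2 * M * card (W' i))" by (rule mult_left_mono) simp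
      then have "card V \<le> D * (2 * M) * card (W' i)" using Wi(2) by (metis le_trans mult.assoc)
      moreover have "W' i \<subseteq> W i" by (auto simp: W'_def)
      ultimately show ?thesis using Wi(1) by blast
    qed
    obtain \<phi> where \<phi>: "\<forall>j<k. \<phi> j \<in> W' j \<and> (\<forall>i<j. \<phi> i \<noteq> \<phi> j \<and> \<chi> (\<phi> j) (\<phi> i) = c i j)"
      using N[rule_format, of V \<chi> W' c] V big few W' c by auto
    have "\<forall>j<Suc k. (\<phi>(k := v)) j \<in> W j \<and> (\<forall>i<j. (\<phi>(k := v)) i \<noteq> (\<phi>(k := v)) j
        \<and> \<chi> ((\<phi>(k := v)) j) ((\<phi>(k := v)) i) = c i j)"
      using \<phi> v(1) by (auto simp: less_Suc_eq W'_def)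
    then show "\<exists>\<phi>. \<forall>j<Suc k. \<phi> j \<in> W j \<and> (\<forall>i<j. \<phi> i \<noteq> \<phi> j \<and> \<chi> (\<phi> j) (\<phi> i) = c i j)"
      by blast
  qed
qed

section \<open>Gadgets and the lower bound\<close>

text \<open>For \<open>r \<ge> 3\<close> the two edges share just \<open>0\<close> and
  \<open>1\<close>, and each has \<open>r - 2\<close> vertices of its own, so that
  \<open>{..<2 * r - 2}\<close> is the vertex set.\<close>

definition gadget :: "nat \<Rightarrow> nat set set" where
  "gadget r = {{..<r}, {0, 1} \<union> {r..<2 * r - 2}}"

definition gadget_pairs :: "nat \<Rightarrow> nat set set" where
  "gadget_pairs r = {P. card P = 2 \<and> (\<exists>F\<in>gadget r. P \<subseteq> F)}"

lemma gadget_Int: "(r::nat) \<ge> 3 \<Longrightarrow> {..<r} \<inter> ({0, 1} \<union> {r..<2 * r - 2}) = {0, 1}"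
  by auto

lemma gadget_card_snd: "(r::nat) \<ge> 3 \<Longrightarrow> card ({0, 1} \<union> {r..<2 * r - 2}) = r"
  by (subst card_Un_disjoint) auto

lemma gadget_neq: "(r::nat) \<ge> 3 \<Longrightarrow> {..<r} \<noteq> {0, 1} \<union> {r..<2 * r - 2}"
proof -
  assume "3 \<le> r"
  then have "2 \<in> {..<r}" "2 \<notin> {0, 1} \<union> {r..<2 * r - 2}" by auto
  then show ?thesis by blast
qed

lemma uniform_gadget: "r \<ge> 3 \<Longrightarrow> uniform_hypergraph r {..<2 * r - 2} (gadget r)"
  using gadget_card_snd[of r] by (auto simp: uniform_hypergraph_def gadget_def)

lemma card_gadget: "r \<ge> 3 \<Longrightarrow> card (gadget r) = 2"
  using gadget_neq[of r] unfolding gadget_def by simp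

lemma sparse_triples_gadget:
  assumes "r \<ge> 3"
  shows "sparse_triples (gadget r)"
proof -
  have c: "card ({..<r} \<inter> ({0, 1} \<union> {r..<2 * r - 2})) = 2"
    "card (({0, 1} \<union> {r..<2 * r - 2}) \<inter> {..<r}) = 2"
    using gadget_Int[OF assms] by (simp_all only: Int_commute) auto
  show ?thesis
    unfolding sparse_triples_def
  proof (intro conjI ballI impI; (elim conjE)?)
    fix A B assume "A \<in> gadget r" "B \<in> gadget r" "A \<noteq> B"
    then show "card (A \<inter> B) \<le> 2" using c unfolding gadget_def by (elim insertE emptyE) simp_all
  next
    fix A B C assume "A \<in> gadget r" "B \<in> gadget r" "C \<in> gadget r" "A \<noteq> B" "C \<noteq> A" "C \<noteq> B"
    then show "card (C \<inter> (A \<union> B)) \<le> 1" unfolding gadget_def by blast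
  qed
qed

text \<open>Each edge contains \<open>r choose 2\<close> pairs, and only \<open>{0, 1}\<close> is
  counted twice.\<close>

lemma card_gadget_pairs:
  assumes "r \<ge> 3"
  shows "card (gadget_pairs r) = r * r - r - 1"
proof -
  define A where "A = {..<r}"
  define B where "B = {0, 1} \<union> {r..<2 * r - 2}"
  define PA where "PA = {P. P \<subseteq> A \<and> card P = 2}"
  define PB where "PB = {P. P \<subseteq> B \<and> card P = 2}"
  have fin: "finite A" "finite B" by (simp_all add: A_def B_def)
  have c: "card A = r" "card B = r" using gadget_card_snd[OF assms] by (simp_all add: A_def B_def)
  have cP: "card PA = r choose 2" "card PB = r choose 2"
    using n_subsets[OF fin(1)] n_subsets[OF fin(2)] c by (simp_all add: PA_def PB_def)
  have "PA \<inter> PB = {P. P \<subseteq> A \<inter> B \<and> card P = 2}" by (auto simp: PA_def PB_def)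
  also have "A \<inter> B = {0, 1}" unfolding A_def B_def by (rule gadget_Int[OF assms])
  also have "card {P. P \<subseteq> {0, 1 :: nat} \<and> card P = 2} = 1"
    using n_subsets[of "{0, 1 :: nat}" 2] by (simp add: choose_two)
  finally have cI: "card (PA \<inter> PB) = 1" .
  have finP: "finite PA" "finite PB" using fin by (auto simp: PA_def PB_def)
  have "gadget r = {A, B}" by (simp add: gadget_def A_def B_def)
  then have U: "gadget_pairs r = PA \<union> PB"
    unfolding gadget_pairs_def PA_def PB_def by blast
  have "card (gadget_pairs r) + 1 = 2 * (r choose 2)"
    using card_Un_Int[OF finP] cP cI unfolding U by simp
  moreover have "2 * (r choose 2) = r * (r - 1)"
    unfolding choose_two by (cases r) auto
  ultimately show ?thesis by (simp add: diff_mult_distrib2)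
qed

section \<open>Packing affine copies of coloured gadgets\<close>

context cyclotomic_colouring
begin

text \<open>A covered pair determines its copy. Multipliers of colour 0 preserve the colours of
  differences, so the colour reveals the base gadget \<open>t\<close> and the pair in it; the
  difference then gives \<open>x\<close> up to sign, \<open>half_class\<close> fixes the sign, and
  \<open>b\<close> follows. This is the separation needed for lifting; there are
  \<open>s * q * p\<close> copies with two edges each.\<close>

lemma sparse_triples_from_gadgets:
  fixes \<phi> :: "nat \<Rightarrow> nat \<Rightarrow> int" and l :: "nat set \<Rightarrow> nat"
  assumes r: "r \<ge> 3"
    and l: "inj_on l (gadget_pairs r)" "l ` gadget_pairs r \<subseteq> {..<e}"
    and \<phi>: "\<And>t i j. t < s \<Longrightarrow> j < 2 * r - 2 \<Longrightarrow> i < j \<Longrightarrow> \<phi> t i \<noteq> \<phi> t j \<and>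
      col (\<phi> t j - \<phi> t i) = (if {i, j} \<in> gadget_pairs r then 1 + (t * e + l {i, j}) else 0)"
    and range: "\<And>t i. t < s \<Longrightarrow> i < 2 * r - 2 \<Longrightarrow> \<phi> t i \<in> residues"
  shows "\<exists>E. uniform_hypergraph r residues E \<and> sparse_triples E \<and> card E = 2 * s * q * p"
proof -
  \<comment> \<open>Colour 0 is reserved for cross pairs; the summand 1 shifts the codes
    \<open>t * e + l P\<close> of covered pairs away from it.\<close>
  define c where "c t P = (if P \<in> gadget_pairs r then 1 + (t * e + l P) else 0)" for t P
  define X where "X = {..<2 * r - 2}"
  define T where "T = {..<s} \<times> half_class \<times> residues"
  define \<psi> where "\<psi> = (\<lambda>(t, x, b) i. (x * \<phi> t i + b) mod int p)"
  have ndvd: "\<not> int p dvd \<phi> t i - \<phi> t j" if "t < s" "i \<in> X" "j \<in> X" "i \<noteq> j" for t i j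
    using that \<phi>[of t i j] \<phi>[of t j i] range[of t i] range[of t j] residue_eqI[of "\<phi> t i" "\<phi> t j"]
    by (cases "i < j") (auto simp: X_def)
  have col_\<phi>: "col (\<phi> t i - \<phi> t j) = c t {i, j}" if "t < s" "i \<in> X" "j \<in> X" "i \<noteq> j" for t i j
  proof (cases "i < j")
    case True
    then have "col (- (\<phi> t j - \<phi> t i)) = c t {i, j}"
      unfolding col_uminus using \<phi>[of t j i] that by (simp add: X_def c_def)
    then show ?thesis by simp
  next
    case False
    then show ?thesis using \<phi>[of t i j] that by (simp add: X_def c_def insert_commute)
  qed
  have diff: "[\<psi> (t, x, b) i - \<psi> (t, x, b) j = x * (\<phi> t i - \<phi> t j)] (mod int p)" for t x b i j
  proof -
    have "[\<psi> (t, x, b) i - \<psi> (t, x, b) j = (x * \<phi> t i + b) - (x * \<phi> t j + b)] (mod int p)"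
      unfolding \<psi>_def by (intro cong_diff) (simp_all add: cong_def)
    then show ?thesis by (simp add: right_diff_distrib)
  qed
  have prime_int: "prime (int p)" using prime_p by simp
  have nd: "\<not> int p dvd x * (\<phi> t i - \<phi> t j)"
    if "t < s" "x \<in> half_class" "i \<in> X" "j \<in> X" "i \<noteq> j" for t x i j
    using ndvd that half_class_not_dvd prime_int by (simp add: prime_dvd_mult_iff)
  have \<psi>_ne: "\<psi> (t, x, b) i \<noteq> \<psi> (t, x, b) j"
    if "(t, x, b) \<in> T" "i \<in> X" "j \<in> X" "i \<noteq> j" for t x b i j
    using diff[of t x b i j] nd[of t x i j] that by (auto simp: T_def cong_0_iff dest: cong_sym)
  have col_\<psi>: "col (\<psi> (t, x, b) i - \<psi> (t, x, b) j) = c t {i, j}"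
    if "(t, x, b) \<in> T" "i \<in> X" "j \<in> X" "i \<noteq> j" for t x b i j
  proof -
    have t: "t < s" "x \<in> half_class" using that by (auto simp: T_def)
    have "col (x * (\<phi> t i - \<phi> t j)) = col (\<phi> t i - \<phi> t j)"
      using col_mult[OF half_class_not_dvd[OF t(2)] ndvd[OF t(1) that(2-4)]] t(2) col_less
      by (simp add: half_class_def)
    then show ?thesis using col_cong[OF diff] col_\<phi> t that by metis
  qed
  have inj: "inj_on (\<psi> \<tau>) X" if "\<tau> \<in> T" for \<tau>
  proof (rule inj_onI, rule ccontr)
    fix i j assume "i \<in> X" "j \<in> X" "\<psi> \<tau> i = \<psi> \<tau> j" "i \<noteq> j"
    then show False using \<psi>_ne that by (cases \<tau>) metis
  qed
  have sub: "\<psi> \<tau> ` X \<subseteq> residues" if "\<tau> \<in> T" for \<tau>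
    using p_gt by (auto simp: \<psi>_def split: prod.split)
  have uniq: False
    if \<tau>: "(t, x, b) \<in> T" "(t', x', b') \<in> T" "(t, x, b) \<noteq> (t', x', b')"
      and X: "i \<in> X" "j \<in> X" "i' \<in> X" "j' \<in> X" and ne: "i \<noteq> j" "i' \<noteq> j'"
      and P: "{i, j} \<in> gadget_pairs r"
      and yi: "\<psi> (t, x, b) i = \<psi> (t', x', b') i'" and yj: "\<psi> (t, x, b) j = \<psi> (t', x', b') j'"
    for t x b t' x' b' i j i' j'
  proof -
    have m: "t < s" "x \<in> half_class" "b \<in> residues" "x' \<in> half_class" "b' \<in> residues"
      using \<tau> by (auto simp: T_def)
    \<comment> \<open>Only \<open>{i, j}\<close> is known to be covered. Its colour is nonzero,
      which rules out a cross pair on the other side.\<close>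
    have "c t {i, j} = c t' {i', j'}"
      using col_\<psi>[OF \<tau>(1) X(1,2) ne(1)] col_\<psi>[OF \<tau>(2) X(3,4) ne(2)] yi yj by simp
    then have P': "{i', j'} \<in> gadget_pairs r" and te: "t * e + l {i, j} = t' * e + l {i', j'}"
      using P by (auto simp: c_def split: if_splits)
    have le: "l {i, j} < e" "l {i', j'} < e" using l(2) P P' by auto
    \<comment> \<open>Since \<open>l\<close> takes values below \<open>e\<close>, the code splits
      uniquely into quotient \<open>t\<close> and remainder.\<close>
    have "t = (t * e + l {i, j}) div e" using le by simp
    also have "\<dots> = t'" unfolding te using le by simp
    finally have t: "t' = t" by simp
    then have "l {i, j} = l {i', j'}" using te by simp
    then have "{i, j} = {i', j'}" using l(1) P P' by (meson inj_onD)
    then have ij: "i' = i \<and> j' = j \<or> i' = j \<and> j' = i" by (auto simp: doubleton_eq_iff)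
    define d where "d = \<phi> t i - \<phi> t j"
    have d: "\<not> int p dvd d" unfolding d_def by (rule ndvd[OF m(1) X(1,2) ne(1)])
    have xd: "[x * d = x' * (\<phi> t i' - \<phi> t j')] (mod int p)"
      using diff[of t x b i j] diff[of t x' b' i' j'] yi yj t d_def
      by (metis cong_sym cong_trans)
    have half: "[u = v] (mod int p)" if "[u * d = v * d] (mod int p)" for u v
    proof -
      have "int p dvd (u - v) * d" using that by (simp add: cong_iff_dvd_diff left_diff_distrib)
      then show ?thesis using d prime_int by (simp add: prime_dvd_mult_iff cong_iff_dvd_diff)
    qed
    show False
      using ij
    proof
      assume ij: "i' = i \<and> j' = j"
      then have "[x = x'] (mod int p)" using xd half by (simp add: d_def)
      then have x: "x' = x" using half_class_unique m by blast
      have "[x * \<phi> t i + b = x * \<phi> t i + b'] (mod int p)"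
        using yi ij t x by (simp add: \<psi>_def cong_def)
      then have "[b = b'] (mod int p)" by (simp only: cong_add_lcancel)
      then have "b = b'" using m residue_eqI by (simp add: cong_iff_dvd_diff)
      then show False using \<tau>(3) t x by simp
    next
      \<comment> \<open>A swapped pair would give \<open>x = - x'\<close> modulo \<open>p\<close>,
        hence \<open>x = x'\<close> by the choice of \<open>half_class\<close>, and then
        \<open>p\<close> would divide \<open>2 * x\<close>.\<close>
      assume ij: "i' = j \<and> j' = i"
      then have xd': "[x * d = - x' * d] (mod int p)" using xd by (simp add: d_def algebra_simps)
      then have *: "[x = - x'] (mod int p)" by (rule half)
      then have "x = x'" using half_class_unique m by blast
      then have "int p dvd 2 * x" using * by (simp add: cong_iff_dvd_diff)
      then have "int p dvd 2"
        using half_class_not_dvd[OF m(2)] prime_int by (simp add: prime_dvd_mult_iff)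
      then show False using p_gt zdvd_imp_le[of "int p" 2] by simp
    qed
  qed
  have sep: "card (\<psi> \<tau> ` F \<inter> \<psi> \<tau>' ` X) \<le> 1"
    if "\<tau> \<in> T" "\<tau>' \<in> T" "\<tau> \<noteq> \<tau>'" "F \<in> gadget r" for \<tau> \<tau>' F
  proof -
    have FX: "F \<subseteq> X"
      using uniform_gadget[OF r] that by (auto simp: uniform_hypergraph_def X_def)
    have fin: "finite (\<psi> \<tau> ` F \<inter> \<psi> \<tau>' ` X)" by (simp add: X_def)
    obtain t x b where \<tau>: "\<tau> = (t, x, b)" by (cases \<tau>) auto
    obtain t' x' b' where \<tau>': "\<tau>' = (t', x', b')" by (cases \<tau>') auto
    have "\<forall>y\<in>\<psi> \<tau> ` F \<inter> \<psi> \<tau>' ` X. \<forall>z\<in>\<psi> \<tau> ` F \<inter> \<psi> \<tau>' ` X. y = z"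
    proof (intro ballI, rule ccontr)
      fix y z assume yz: "y \<in> \<psi> \<tau> ` F \<inter> \<psi> \<tau>' ` X" "z \<in> \<psi> \<tau> ` F \<inter> \<psi> \<tau>' ` X" and ne: "y \<noteq> z"
      obtain i i' where i: "y = \<psi> \<tau> i" "y = \<psi> \<tau>' i'" "i \<in> F" "i' \<in> X" using yz by blast
      obtain j j' where j: "z = \<psi> \<tau> j" "z = \<psi> \<tau>' j'" "j \<in> F" "j' \<in> X" using yz by blast
      have ij: "i \<noteq> j" "i' \<noteq> j'" using i j ne by auto
      then have "{i, j} \<in> gadget_pairs r" using i j that(4) by (auto simp: gadget_pairs_def)
      then show False
        using uniq[of t x b t' x' b' i j i' j'] that i j ij FX \<tau> \<tau>' by (metis subsetD)
    qed
    then show ?thesis by (simp only: card_le_Suc0_iff_eq[OF fin] One_nat_def)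
  qed
  have "finite X" by (simp add: X_def)
  moreover have "r \<ge> 2" using r by simp
  ultimately have lift: "uniform_hypergraph r residues ((\<lambda>(\<tau>, F). \<psi> \<tau> ` F) ` (T \<times> gadget r))"
    "sparse_triples ((\<lambda>(\<tau>, F). \<psi> \<tau> ` F) ` (T \<times> gadget r))"
    "card ((\<lambda>(\<tau>, F). \<psi> \<tau> ` F) ` (T \<times> gadget r)) = card T * card (gadget r)"
    using sparse_triples_lift[where \<psi> = \<psi> and T = T and V = residues,
        OF uniform_gadget[OF r, folded X_def] sparse_triples_gadget[OF r] _ _ inj sub sep]
    by blast+
  have "card T * card (gadget r) = 2 * s * q * p"
    using card_gadget[OF r] card_half_class by (simp add: T_def card_cartesian_product)
  then show ?thesis using lift by metis
qed

end

text \<open>On \<open>p\<close> vertices the packing has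
  \<open>2 * s * q * p = s * p * (p - 1) / M\<close> edges. Its density tends to
  \<open>1 / e\<close>, because \<open>s / M\<close> is close to \<open>1 / e\<close> for large
  \<open>M\<close>, and \<open>(p - 1) / p\<close> is close to 1.\<close>

lemma dense_sparse_triples_exists:
  fixes r :: nat and \<epsilon> :: real
  assumes r: "r \<ge> 3" and \<epsilon>: "\<epsilon> > 0"
  shows "\<exists>N E. N > 0 \<and> uniform_hypergraph r {0..<int N} E \<and> sparse_triples E
    \<and> (1 / ((real r)\<^sup>2 - real r - 1) - \<epsilon>) * (real N)\<^sup>2 \<le> real (card E)"
proof -
  define e where "e = r * r - r - 1"
  have r3: "3 * r \<le> r * r" using r by (intro mult_right_mono) auto
  then have "e + r + 1 = r * r" using r unfolding e_def by linarith
  then have "real (e + r + 1) = real (r * r)" by (rule arg_cong)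
  then have e_real: "real e = (real r)\<^sup>2 - real r - 1" by (simp add: power2_eq_square)
  have e_pos: "e > 0" using r3 r unfolding e_def by linarith
  \<comment> \<open>Both \<open>M = 2 ^ B\<close> and \<open>p\<close> exceed
    \<open>B \<ge> 2 / \<epsilon>\<close>, so each of the two error terms costs at most
    \<open>\<epsilon> / 2\<close>. The bound \<open>B > 2\<close> excludes
    \<open>p = 2\<close>.\<close>
  obtain B :: nat where B: "2 / \<epsilon> \<le> real B" "B > 2"
    using real_arch_simple[of "max (2 / \<epsilon>) 3"] by auto
  define M where "M = (2 ^ B :: nat)"
  have "B < M" unfolding M_def by (rule less_exp)
  then have M: "2 / \<epsilon> \<le> real M" "M > 0" using B(1) by auto
  \<comment> \<open>There are \<open>M - 1\<close> nonzero colours, and every base gadget consumes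
    \<open>e\<close> of them.\<close>
  define s where "s = (M - 1) div e"
  have se: "s * e + 1 \<le> M" using M(2) div_times_less_eq_dividend[of "M - 1" e] unfolding s_def by linarith
  have "M - 1 < (s + 1) * e"
    using dividend_less_div_times[OF e_pos, of "M - 1"] by (simp add: s_def)
  then have s_lower: "M \<le> s * e + e" by simp
  obtain l where l: "bij_betw l (gadget_pairs r) {..<e}"
  proof -
    have "finite (gadget_pairs r)"
      using card_gadget_pairs[OF r] e_pos card.infinite by (fastforce simp: e_def)
    then show ?thesis using that card_gadget_pairs[OF r] ex_bij_betw_finite_nat
      by (metis e_def atLeast0LessThan)
  qed
  then have l': "inj_on l (gadget_pairs r)" "l ` gadget_pairs r \<subseteq> {..<e}"
    by (auto simp: bij_betw_def)
  define k where "k = 2 * r - 2"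
  obtain N where N: "\<forall>(V :: int set) \<chi> W (c :: nat \<Rightarrow> nat \<Rightarrow> nat).
    finite V \<and> N \<le> card V \<and> few_bad (8 * M\<^sup>2) M V \<chi> \<and>
    (\<forall>i<k. W i \<subseteq> V \<and> card V \<le> 1 * card (W i)) \<and> (\<forall>i j. c i j < M)
    \<longrightarrow> (\<exists>\<phi>. \<forall>j<k. \<phi> j \<in> W j \<and> (\<forall>i<j. \<phi> i \<noteq> \<phi> j \<and> \<chi> (\<phi> j) (\<phi> i) = c i j))"
    using coloured_clique_exists[where 'a = int and k = k and C = "8 * M\<^sup>2" and M = M and D = 1] by (rule exE)
  \<comment> \<open>The exponent \<open>Suc B\<close> provides divisibility of \<open>p - 1\<close>
    by \<open>2 * M\<close>, as the colouring requires.\<close>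
  obtain p where p: "p > N + B" "prime p" "2 ^ Suc B dvd p - (1::nat)"
    using exists_prime_cong_1_mod_two_power by blast
  have odd_p: "odd p" using p(1,2) B(2) prime_odd_nat by simp
  obtain q where q: "p - 1 = 2 * M * q" using p(3) by (auto simp: M_def dvd_def)
  obtain ind where "discrete_log p ind" using discrete_log_exists[OF p(2) odd_p] by blast
  then interpret discrete_log p ind .
  interpret cyclotomic_colouring p ind M q
    by unfold_locales (use q p(1) in simp)
  have few: "few_bad (8 * M\<^sup>2) M residues (\<lambda>v w. col (v - w))"
    unfolding few_bad_def using few_bad_vertices by simp
  \<comment> \<open>Each base gadget is found separately among all residues. Different ones may
    overlap, as only the colours of their covered differences must be distinct.\<close>
  have "\<exists>\<phi>. \<forall>j<k. \<phi> j \<in> residues \<and> (\<forall>i<j. \<phi> i \<noteq> \<phi> j \<and> col (\<phi> j - \<phi> i) =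
      (if {i, j} \<in> gadget_pairs r then 1 + (t * e + l {i, j}) else 0))" if t: "t < s" for t
  proof -
    have "(if {i, j} \<in> gadget_pairs r then 1 + (t * e + l {i, j}) else 0) < M" for i j
    proof -
      have "(t + 1) * e \<le> s * e" using t by (intro mult_right_mono) auto
      moreover have "l {i, j} < e" if "{i, j} \<in> gadget_pairs r" using l' that by blast
      ultimately show ?thesis using se M(2) by auto
    qed
    then show ?thesis
      using N[rule_format, of residues "\<lambda>v w. col (v - w)" "\<lambda>_. residues"
          "\<lambda>i j. if {i, j} \<in> gadget_pairs r then 1 + (t * e + l {i, j}) else 0"] few p(1)
      by simp
  qed
  then obtain \<phi> where \<phi>: "\<And>t. t < s \<Longrightarrow> \<forall>j<k. \<phi> t j \<in> residues \<and>
      (\<forall>i<j. \<phi> t i \<noteq> \<phi> t j \<and> col (\<phi> t j - \<phi> t i) =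
      (if {i, j} \<in> gadget_pairs r then 1 + (t * e + l {i, j}) else 0))"
    by metis
  obtain E where E: "uniform_hypergraph r residues E" "sparse_triples E" "card E = 2 * s * q * p"
    using sparse_triples_from_gadgets[OF r l', of s \<phi>] \<phi> unfolding k_def by blast
  have "(1 / real e - \<epsilon>) * (real p)\<^sup>2 \<le> real (card E)"
  proof -
    have pos: "real p > 0" "real M > 0" "real e > 0" using p(1) M(2) e_pos by auto
    have pq: "2 * real M * real q = real p - 1"
      using q p(1) by (metis of_nat_1 of_nat_diff of_nat_mult of_nat_numeral One_nat_def Suc_leI gr_implies_not0 not_gr_zero)
    have cE: "real (card E) = real s * real p * (real p - 1) / real M"
      unfolding pq[symmetric] using pos E(3) by (simp add: field_simps)
    have "real M \<le> real (s * e + e)" using s_lower by (simp only: of_nat_le_iff)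
    then have "(real M - real e) / (real e * real M) \<le> (real s * real e) / (real e * real M)"
      by (intro divide_right_mono) auto
    then have a: "1 / real e - 1 / real M \<le> real s / real M"
      using pos by (simp add: diff_divide_distrib)
    have "real (s * e + 1) \<le> real M" using se by (simp only: of_nat_le_iff)
    moreover have "real s * 1 \<le> real s * real e" using e_pos by (intro mult_left_mono) auto
    ultimately have b: "real s / real M \<le> 1" using pos by (simp add: field_simps)
    have c: "1 / real M \<le> \<epsilon> / 2" using M \<epsilon> pos by (simp add: field_simps)
    have "2 / \<epsilon> \<le> real p" using B(1) p(1) by simp
    then have d: "1 / real p \<le> \<epsilon> / 2" using \<epsilon> pos by (simp add: field_simps)
    have "(real s / real M) * (1 / real p) \<le> 1 * (\<epsilon> / 2)"
      using b d pos \<epsilon> by (intro mult_mono) auto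
    then have "1 / real e - \<epsilon> \<le> (real s / real M) * (1 - 1 / real p)"
      using a c unfolding right_diff_distrib by linarith
    then have "(1 / real e - \<epsilon>) * (real p)\<^sup>2 \<le> (real s / real M) * (1 - 1 / real p) * (real p)\<^sup>2"
      by (rule mult_right_mono) simp
    also have "\<dots> = real (card E)"
      unfolding cE using pos by (simp add: field_simps power2_eq_square)
    finally show ?thesis .
  qed
  then show ?thesis
    using E p(1) unfolding e_real by (intro exI[of _ p] exI[of _ E]) simp
qed

section \<open>From one dense example to the limit\<close>

lemma f_max_ge:
  assumes "uniform_hypergraph r {..<n} E" "G_free v e E"
  shows "card E \<le> f_max r n v e"
  unfolding f_max_def using assms finite_free_sizes by (intro Max_ge) auto

lemma f_max_witness:
  assumes "e \<ge> 1"
  obtains E :: "nat set set" where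
    "uniform_hypergraph r {..<n} E" "G_free v e E" "card E = f_max r n v e"
proof -
  have "f_max r n v e \<in> {card E | E :: nat set set. uniform_hypergraph r {..<n} E \<and> G_free v e E}"
    unfolding f_max_def by (rule Max_in[OF finite_free_sizes free_sizes_nonempty[OF assms]])
  then show ?thesis using that by auto
qed

text \<open>Blow up by the largest \<open>m \<le> n div N\<close> congruent to 1 modulo
  \<open>fact N\<close>. It is coprime to all positive \<open>i < N\<close>, and
  \<open>N * m\<close> falls short of \<open>n\<close> by at most a constant independent of
  \<open>n\<close>.\<close>

lemma f_max_lower:
  assumes r: "r \<ge> 2" and N: "N > 0"
    and E: "uniform_hypergraph r {0..<int N} E" "sparse_triples E"
  shows "\<exists>d. \<forall>n\<ge>N. \<exists>m. real n - d \<le> real (N * m) \<and> m\<^sup>2 * card E \<le> f_max r n (3 * r - 4) 3"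
proof (intro exI[of _ "real (N * (fact N + 1))"] allI impI)
  fix n assume n: "n \<ge> N"
  define K where "K = (fact N :: nat)"
  define u where "u = n div N"
  define m where "m = (u - 1) div K * K + 1"
  have K: "K > 0" by (simp add: K_def)
  have u: "u \<ge> 1" using n N by (simp add: u_def div_greater_zero_iff Suc_le_eq)
  have mu: "m \<le> u" using u div_times_less_eq_dividend[of "u - 1" K] unfolding m_def by linarith
  have "u - 1 < (u - 1) div K * K + K" using dividend_less_div_times[OF K, of "u - 1"] by simp
  then have um: "u \<le> m + K" by (simp add: m_def)
  have Nu: "N * u \<le> n" "n < N * u + N"
    using dividend_less_times_div[OF N, of n] by (simp_all add: u_def)
  have "N * u \<le> N * (m + K)" using um by (rule mult_left_mono) simp
  then have "n \<le> N * m + N * (K + 1)" using Nu(2) by (simp add: distrib_left)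
  then have "real n \<le> real (N * m + N * (K + 1))" by (simp only: of_nat_le_iff)
  then have lower: "real n - real (N * (fact N + 1)) \<le> real (N * m)" by (simp add: K_def)
  have cop: "coprime i m" if "0 < i" "i < N" for i
  proof -
    have "i dvd K" using that by (simp add: K_def dvd_fact)
    then have "i dvd (u - 1) div K * K" by simp
    then show ?thesis unfolding m_def
      by (metis coprime_add_one_right coprime_divisors dvd_refl)
  qed
  obtain E' :: "nat set set" where E': "uniform_hypergraph r {..<N * m} E'" "sparse_triples E'"
    "card E' = m\<^sup>2 * card E"
    using sparse_triples_blow_up[OF E r _ cop] by (auto simp: m_def)
  have "N * m \<le> n" using mu Nu(1) by (meson le_trans mult_le_mono2)
  then have "{..<N * m} \<subseteq> {..<n}" by simp
  then have "uniform_hypergraph r {..<n} E'"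
    using E'(1) unfolding uniform_hypergraph_def by (meson subset_trans)
  then have "card E' \<le> f_max r n (3 * r - 4) 3"
    using G_free_if_sparse_triples E' r by (intro f_max_ge) blast+
  then show "\<exists>m. real n - real (N * (fact N + 1)) \<le> real (N * m)
      \<and> m\<^sup>2 * card E \<le> f_max r n (3 * r - 4) 3"
    using E'(3) lower by auto
qed

theorem theorem3:
  fixes r :: nat
  assumes "r \<ge> 4"
  shows "(\<lambda>n. real (f_max r n (3 * r - 4) 3) / (real n)\<^sup>2)
           \<longlonglongrightarrow> 1 / ((real r)\<^sup>2 - real r - 1)"
proof (rule order_tendstoI)
  define e where "e = (real r)\<^sup>2 - real r - 1"
  have "4 * real r \<le> real r * real r" using assms by (intro mult_right_mono) auto
  moreover have "real r \<ge> 4" using assms by simp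
  ultimately have e: "e > 0" unfolding e_def power2_eq_square by linarith
  {
    fix a assume "a < 1 / ((real r)\<^sup>2 - real r - 1)"
    then have a: "a < 1 / e" by (simp add: e_def)
    \<comment> \<open>Half the gap keeps \<open>1 / e - \<epsilon>\<close> strictly above
      \<open>a\<close>; the cap \<open>1 / e\<close> keeps it nonnegative, so that inequalities can
      be multiplied by it.\<close>
    define \<epsilon> where "\<epsilon> = min ((1 / e - a) / 2) (1 / e)"
    have "\<epsilon> \<le> (1 / e - a) / 2" unfolding \<epsilon>_def by (rule min.cobounded1)
    then have \<epsilon>: "\<epsilon> > 0" "\<epsilon> \<le> 1 / e" "a < 1 / e - \<epsilon>" using a e by (simp_all add: \<epsilon>_def)
    obtain N E where N: "N > 0" and E: "uniform_hypergraph r {0..<int N} E" "sparse_triples E"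
      and cE: "(1 / e - \<epsilon>) * (real N)\<^sup>2 \<le> real (card E)"
      using dense_sparse_triples_exists[of r \<epsilon>] assms \<epsilon>(1) unfolding e_def by auto
    obtain d where d: "\<And>n. n \<ge> N \<Longrightarrow> \<exists>m. real n - d \<le> real (N * m)
        \<and> m\<^sup>2 * card E \<le> f_max r n (3 * r - 4) 3"
      using f_max_lower[OF _ N E] assms by auto
    have "(\<lambda>n. (1 / e - \<epsilon>) * (1 - d / real n)\<^sup>2) \<longlonglongrightarrow> (1 / e - \<epsilon>) * (1 - 0)\<^sup>2"
      by (intro tendsto_intros lim_const_over_n)
    then have "eventually (\<lambda>n. a < (1 / e - \<epsilon>) * (1 - d / real n)\<^sup>2) sequentially"
      using \<epsilon>(3) by (intro order_tendstoD(1)) auto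
    moreover have "eventually (\<lambda>n. n \<ge> N) sequentially" by (rule eventually_ge_at_top)
    \<comment> \<open>Squaring \<open>real n - d \<le> real (N * m)\<close> needs a nonnegative left
      side.\<close>
    moreover have "eventually (\<lambda>n. real n \<ge> d) sequentially"
      by (rule eventually_at_top_linorderI[of "nat \<lceil>d\<rceil>"]) linarith
    ultimately show "eventually (\<lambda>n. a < real (f_max r n (3 * r - 4) 3) / (real n)\<^sup>2) sequentially"
    proof eventually_elim
      case (elim n)
      obtain m where m: "real n - d \<le> real (N * m)" "m\<^sup>2 * card E \<le> f_max r n (3 * r - 4) 3"
        using d elim by blast
      have n: "real n > 0" using N elim by simp
      have "(1 / e - \<epsilon>) * (real n - d)\<^sup>2 \<le> (1 / e - \<epsilon>) * (real (N * m))\<^sup>2"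
        using m(1) elim \<epsilon>(2) by (intro mult_left_mono power_mono) auto
      also have "\<dots> = (real m)\<^sup>2 * ((1 / e - \<epsilon>) * (real N)\<^sup>2)"
        by (simp add: power_mult_distrib)
      also have "\<dots> \<le> (real m)\<^sup>2 * real (card E)" using cE by (rule mult_left_mono) simp
      also have "\<dots> = real (m\<^sup>2 * card E)" by simp
      also have "\<dots> \<le> real (f_max r n (3 * r - 4) 3)" using m(2) by (simp only: of_nat_le_iff)
      finally have "(1 / e - \<epsilon>) * (real n - d)\<^sup>2 / (real n)\<^sup>2
          \<le> real (f_max r n (3 * r - 4) 3) / (real n)\<^sup>2"
        by (rule divide_right_mono) simp
      moreover have "(1 - d / real n)\<^sup>2 = (real n - d)\<^sup>2 / (real n)\<^sup>2"
        using n by (simp add: power_divide[symmetric] diff_divide_distrib)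
      ultimately show ?case using elim by simp
    qed
  }
  {
    fix a assume "1 / ((real r)\<^sup>2 - real r - 1) < a"
    then have a: "1 / e < a" by (simp add: e_def)
    \<comment> \<open>The bound of \<open>card_free_le\<close> divided by
      \<open>e * n\<^sup>2\<close>; the summand \<open>2 / n\<close> comes from the edges with large
      intersections.\<close>
    have "(\<lambda>n. 1 / e + 2 / real n) \<longlonglongrightarrow> 1 / e + 0"
      by (intro tendsto_intros lim_const_over_n)
    then have "eventually (\<lambda>n. 1 / e + 2 / real n < a) sequentially"
      using a by (intro order_tendstoD(2)) auto
    moreover have "eventually (\<lambda>n. n \<ge> (1::nat)) sequentially" by (rule eventually_ge_at_top)
    ultimately show "eventually (\<lambda>n. real (f_max r n (3 * r - 4) 3) / (real n)\<^sup>2 < a) sequentially"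
    proof eventually_elim
      case (elim n)
      obtain E :: "nat set set" where E: "uniform_hypergraph r {..<n} E" "G_free (3 * r - 4) 3 E"
        "card E = f_max r n (3 * r - 4) 3"
        by (rule f_max_witness[of 3]) auto
      have "real (card E) * e \<le> (real n)\<^sup>2 + 2 * real n * e"
        using card_free_le[OF E(1,2)] assms by (simp add: e_def)
      then have "real (card E) \<le> ((real n)\<^sup>2 + 2 * real n * e) / e"
        using e by (simp add: pos_le_divide_eq)
      also have "\<dots> = (1 / e + 2 / real n) * (real n)\<^sup>2"
        using e elim by (simp add: field_simps power2_eq_square)
      finally have "real (card E) \<le> (1 / e + 2 / real n) * (real n)\<^sup>2" .
      then have "real (card E) / (real n)\<^sup>2 \<le> 1 / e + 2 / real n"
        using elim by (simp add: divide_le_eq)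
      then show ?case using elim E(3) by simp
    qed
  }
qed

end
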